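(* Let $\Gamma$ be a finite connected simplicial graph which is not a complete graph, and let $\mathcal G$ be a graph of groups decomposition of $A(\Gamma)$ produced by the iterated separating-clique construction described in the context. Then $\mathcal G$ is a vertex-elliptic abelian JSJ-decomposition of $A(\Gamma)$. That is, the Bass–Serre tree $T$ of $\mathcal G$ is an $(\mathcal A,\mathcal H)$-tree, $T$ is universally elliptic, and $T$ dominates every other universally elliptic $(\mathcal A,\mathcal H)$-tree.
   Context: Right-angled Artin groups. For a simplicial graph $\Gamma$, $A(\Gamma)=\langle V(\Gamma)\mid [u,v]=1 \text{ whenever } (u,v)\in E(\Gamma)\rangle$. For an induced subgraph $\Gamma'\subseteq\Gamma$, $A(\Gamma')$ is identified with the subgroup of $A(\Gamma)$ generated by $V(\Gamma')$. A clique is a complete subgraph. A clique $K$ of a graph $\Gamma'$ is separating in $\Gamma'$ if the subgraph $\Gamma'\smallsetminus K$ induced by the vertices not in $K$ is disconnected. Unions such as $\Gamma'_j\cup K$ denote induced subgraphs. Trees. All trees are simplicial and groups act on them by simplicial automorphisms without inversions. An element or a subgroup is elliptic (acts elliptically) if it fixes a point of the tree. Let $\mathcal A$ be the set of abelian subgroups of $A(\Gamma)$ and $\mathcal H=\{\langle v\rangle : v\in V(\Gamma)\}$. An $(\mathcal A,\mathcal H)$-tree is a tree $T$ with an action of $A(\Gamma)$ such that every edge stabilizer is abelian and every $v\in V(\Gamma)$ acts elliptically. An $(\mathcal A,\mathcal H)$-tree $T$ is universally elliptic if every edge stabilizer of $T$ is elliptic in every other $(\mathcal A,\mathcal H)$-tree.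 A tree $T$ dominates a tree $T'$ if every vertex stabilizer of $T$ is elliptic with respect to $T'$. A graph of groups decomposition of $A(\Gamma)$ is a vertex-elliptic abelian JSJ-decomposition if its Bass–Serre tree $T$ is an $(\mathcal A,\mathcal H)$-tree which is universally elliptic and which dominates every other universally elliptic $(\mathcal A,\mathcal H)$-tree. Splitting defined by a separating clique. Let $\Gamma'$ be a connected graph and $K$ a separating clique of $\Gamma'$ of minimal size among separating cliques of $\Gamma'$, and let $\Gamma'_1,\dots,\Gamma'_m$ be the components of $\Gamma'\smallsetminus K$. The splitting of $A(\Gamma')$ defined by $K$ is the following graph of groups: the underlying graph is a star with a central vertex with vertex group $A(K)$ and, for each $j=1,\dots,m$, a valence-one vertex with vertex group $A(\Gamma'_j\cup K)$ joined to the central vertex by an edge with edge group $A(K)$; all edge maps are the natural inclusions. (If $m=2$, one may instead use the one-edge splitting $A(\Gamma'_1\cup K)*_{A(K)}A(\Gamma'_2\cup K)$.) The construction of $\mathcal G$. Every graph of groups occurring has vertex groups of the form $A(\Gamma')$ with $\Gamma'$ a connected induced subgraph of $\Gamma$ and edge groups of the form $A(C)$ with $C$ a clique contained in the subgraphs of both endpoints, with natural inclusions as edge maps. Start with the trivial decomposition, with one vertex and vertex group $A(\Gamma)$. If $\Gamma$ has no separating clique, stop. Otherwise, let $k$ be the minimal size of a separating clique of $\Gamma$ and let $K^1,\dots,K^n$ be all separating cliques of $\Gamma$ of size $k$. The splittings of $A(\Gamma)$ defined by $K^1,\dots,K^n$ are refined into a single splitting $\Lambda$ by processing $K^1,\dots,K^n$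 in turn: at each step the vertex whose subgraph $\Gamma'$ contains $K^i$ as a separating clique is replaced by the splitting of $A(\Gamma')$ defined by $K^i$, and each previously existing edge at that vertex, with edge group $A(C)$ where $C$ is a clique of $\Gamma'$, is reattached to a vertex of the new splitting whose subgraph contains $C$ (such a vertex exists because $C$ is a clique). The vertex groups of $\Lambda$ correspond to connected induced subgraphs $\Gamma^i$ of $\Gamma$. Repeat the same procedure for each $\Gamma^i$ (using all separating cliques of $\Gamma^i$ of minimal size in $\Gamma^i$), extending the resulting splitting of $A(\Gamma^i)$ to a refinement of the decomposition of $A(\Gamma)$ by reattaching edges in the same way. Continue until every subgraph associated to a vertex group is connected and contains no separating clique. The resulting graph of groups decomposition of $A(\Gamma)$ is $\mathcal G$. *)

theory Defs
  imports
    "Graph_Theory.Graph_Theory"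
    "HOL-Algebra.Generated_Groups"
    "HOL-Algebra.Group_Action"
begin

section \<open>Groups given by presentations\<close>

text \<open>A word over \<open>S\<close> is a list of signed letters; \<open>(s, True)\<close> stands for \<open>s\<close> and
  \<open>(s, False)\<close> for its inverse.\<close>

type_synonym 's word = "('s \<times> bool) list"

abbreviation words :: "'s set \<Rightarrow> 's word set" where
  "words S \<equiv> lists (S \<times> UNIV)"

inductive word_eq :: "'s set \<Rightarrow> 's word set \<Rightarrow> 's word \<Rightarrow> 's word \<Rightarrow> bool"
  for S :: "'s set" and R :: "'s word set" where
  refl: "w \<in> words S \<Longrightarrow> word_eq S R w w"
| sym: "word_eq S R v w \<Longrightarrow> word_eq S R w v"
| trans: "word_eq S R u v \<Longrightarrow> word_eq S R v w \<Longrightarrow> word_eq S R u w"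
| cancel: "u @ [(s, b), (s, \<not> b)] @ w \<in> words S \<Longrightarrow>
    word_eq S R (u @ [(s, b), (s, \<not> b)] @ w) (u @ w)"
| relator: "r \<in> R \<Longrightarrow> u @ r @ w \<in> words S \<Longrightarrow> word_eq S R (u @ r @ w) (u @ w)"

definition word_class :: "'s set \<Rightarrow> 's word set \<Rightarrow> 's word \<Rightarrow> 's word set" where
  "word_class S R w = {w'. word_eq S R w w'}"

definition presented_group :: "'s set \<Rightarrow> 's word set \<Rightarrow> 's word set monoid" where
  "presented_group S R =
    \<lparr>carrier = word_class S R ` words S,
     monoid.mult = (\<lambda>X Y. \<Union>x\<in>X. \<Union>y\<in>Y. word_class S R (x @ y)),
     one = word_class S R []\<rparr>"

definition presented_gen :: "'s set \<Rightarrow> 's word set \<Rightarrow> 's \<Rightarrow> 's word set" where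
  "presented_gen S R s = word_class S R [(s, True)]"


section \<open>Right-angled Artin groups\<close>

text \<open>A finite simplicial graph is a \<^term>\<open>\<Gamma>\<close> with \<^term>\<open>pair_graph \<Gamma>\<close>. An induced subgraph is
  given by its vertex set.\<close>

definition raag_relators :: "'v pair_pre_digraph \<Rightarrow> 'v word set" where
  "raag_relators \<Gamma> = {[(u, True), (v, True), (u, False), (v, False)] | u v. (u, v) \<in> parcs \<Gamma>}"

definition raag :: "'v pair_pre_digraph \<Rightarrow> 'v word set monoid" where
  "raag \<Gamma> = presented_group (pverts \<Gamma>) (raag_relators \<Gamma>)"

definition raag_gen :: "'v pair_pre_digraph \<Rightarrow> 'v \<Rightarrow> 'v word set" where
  "raag_gen \<Gamma> = presented_gen (pverts \<Gamma>) (raag_relators \<Gamma>)"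

definition raag_sub :: "'v pair_pre_digraph \<Rightarrow> 'v set \<Rightarrow> 'v word set set" where
  "raag_sub \<Gamma> S = generate (raag \<Gamma>) (raag_gen \<Gamma> ` S)"


section \<open>Separating cliques\<close>

definition clique :: "'v pair_pre_digraph \<Rightarrow> 'v set \<Rightarrow> bool" where
  "clique \<Gamma> K \<longleftrightarrow> K \<subseteq> pverts \<Gamma> \<and> (\<forall>u\<in>K. \<forall>v\<in>K. u \<noteq> v \<longrightarrow> (u, v) \<in> parcs \<Gamma>)"

text \<open>\<^const>\<open>Digraph_Component.connected\<close> requires a nonempty vertex set, but the empty graph must
  not count as disconnected: otherwise every clique would be separated by itself.\<close>

definition disconnected :: "('a, 'b) pre_digraph \<Rightarrow> bool" where
  "disconnected H \<longleftrightarrow> verts H \<noteq> {} \<and> \<not> Digraph_Component.connected H"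

definition separating_clique :: "'v pair_pre_digraph \<Rightarrow> 'v set \<Rightarrow> 'v set \<Rightarrow> bool" where
  "separating_clique \<Gamma> S K \<longleftrightarrow>
    K \<subseteq> S \<and> clique \<Gamma> K \<and> disconnected (with_proj \<Gamma> \<restriction> (S - K))"

definition min_separating_clique :: "'v pair_pre_digraph \<Rightarrow> 'v set \<Rightarrow> 'v set \<Rightarrow> bool" where
  "min_separating_clique \<Gamma> S K \<longleftrightarrow>
    separating_clique \<Gamma> S K \<and> (\<forall>K'. separating_clique \<Gamma> S K' \<longrightarrow> card K \<le> card K')"

text \<open>The graph is symmetric, so strongly connected components are connected components.\<close>

definition components :: "'v pair_pre_digraph \<Rightarrow> 'v set \<Rightarrow> 'v set set" where
  "components \<Gamma> S = pre_digraph.sccs_verts (with_proj \<Gamma> \<restriction> S)"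


section \<open>Trees and group actions on trees\<close>

text \<open>Trees are simple graphs with symmetric arc set. A directed cycle of length two runs back and
  forth along one edge, so only longer ones are cycles of the undirected graph.\<close>

definition simplicial_tree :: "'t pair_pre_digraph \<Rightarrow> bool" where
  "simplicial_tree T \<longleftrightarrow>
    pair_bidirected_digraph T \<and> Digraph_Component.connected (with_proj T) \<and>
    \<not> (\<exists>p. pre_digraph.cycle (with_proj T) p \<and> 3 \<le> length p)"

definition tree_action ::
  "('g, 'm) monoid_scheme \<Rightarrow> 't pair_pre_digraph \<Rightarrow> ('g \<Rightarrow> 't \<Rightarrow> 't) \<Rightarrow> bool" where
  "tree_action G T \<phi> \<longleftrightarrow>
    simplicial_tree T \<and> group_action G (pverts T) \<phi> \<and>
    (\<forall>g\<in>carrier G. \<forall>(x, y)\<in>parcs T. (\<phi> g x, \<phi> g y) \<in> parcs T) \<and>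
    (\<forall>g\<in>carrier G. \<forall>(x, y)\<in>parcs T. \<not> (\<phi> g x = y \<and> \<phi> g y = x))"

text \<open>There are no inversions, so whatever fixes an interior point of an edge fixes both its ends.
  Hence fixing a point is fixing a vertex, and the stabilizer of an edge is the intersection of the
  stabilizers of its ends.\<close>

definition elliptic :: "'t pair_pre_digraph \<Rightarrow> ('g \<Rightarrow> 't \<Rightarrow> 't) \<Rightarrow> 'g set \<Rightarrow> bool" where
  "elliptic T \<phi> H \<longleftrightarrow> (\<exists>x\<in>pverts T. \<forall>h\<in>H. \<phi> h x = x)"

definition edge_stabilizer ::
  "('g, 'm) monoid_scheme \<Rightarrow> ('g \<Rightarrow> 't \<Rightarrow> 't) \<Rightarrow> 't \<times> 't \<Rightarrow> 'g set" where
  "edge_stabilizer G \<phi> e = stabilizer G \<phi> (fst e) \<inter> stabilizer G \<phi> (snd e)"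

definition AH_tree ::
  "'v pair_pre_digraph \<Rightarrow> 't pair_pre_digraph \<Rightarrow> ('v word set \<Rightarrow> 't \<Rightarrow> 't) \<Rightarrow> bool" where
  "AH_tree \<Gamma> T \<phi> \<longleftrightarrow>
    tree_action (raag \<Gamma>) T \<phi> \<and>
    (\<forall>e\<in>parcs T. comm_group (raag \<Gamma> \<lparr>carrier := edge_stabilizer (raag \<Gamma>) \<phi> e\<rparr>)) \<and>
    (\<forall>v\<in>pverts \<Gamma>. elliptic T \<phi> {raag_gen \<Gamma> v})"

text \<open>The type argument \<^typ>\<open>'t\<close> bounds the size of the trees that are quantified over. As
  \<^term>\<open>raag \<Gamma>\<close> is countable for finite \<^term>\<open>\<Gamma>\<close>, every tree contains a countable invariant subtree,
  and an element, or a finitely generated subgroup, is elliptic in the one iff it is in the other;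
  so every infinite \<^typ>\<open>'t\<close> gives the same notion.\<close>

definition universally_elliptic ::
  "'t itself \<Rightarrow> 'v pair_pre_digraph \<Rightarrow> 's pair_pre_digraph \<Rightarrow> ('v word set \<Rightarrow> 's \<Rightarrow> 's) \<Rightarrow> bool" where
  "universally_elliptic _ \<Gamma> T \<phi> \<longleftrightarrow>
    AH_tree \<Gamma> T \<phi> \<and>
    (\<forall>(T' :: 't pair_pre_digraph) \<phi>'. AH_tree \<Gamma> T' \<phi>' \<longrightarrow>
      (\<forall>e\<in>parcs T. elliptic T' \<phi>' (edge_stabilizer (raag \<Gamma>) \<phi> e)))"

definition dominates ::
  "('g, 'm) monoid_scheme \<Rightarrow> 's pair_pre_digraph \<Rightarrow> ('g \<Rightarrow> 's \<Rightarrow> 's) \<Rightarrow>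
   't pair_pre_digraph \<Rightarrow> ('g \<Rightarrow> 't \<Rightarrow> 't) \<Rightarrow> bool" where
  "dominates G T \<phi> T' \<phi>' \<longleftrightarrow> (\<forall>x\<in>pverts T. elliptic T' \<phi>' (stabilizer G \<phi> x))"


section \<open>Graphs of groups and Bass--Serre trees\<close>

text \<open>The label of a vertex or edge is its group, as a subgroup of an ambient group (or, further
  down, a set of vertices of \<open>\<Gamma>\<close>); edge maps are inclusions. The underlying graph \<open>ugraph\<close> carries
  one arc, in an arbitrary direction, for each geometric edge.\<close>

record ('i, 'j, 'l) labelled_graph =
  ugraph :: "('i, 'j) pre_digraph"
  vlabel :: "'i \<Rightarrow> 'l"
  elabel :: "'j \<Rightarrow> 'l"

definition underlying_tree :: "('i, 'j) pre_digraph \<Rightarrow> bool" where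
  "underlying_tree U \<longleftrightarrow>
    wf_digraph U \<and> simplicial_tree (mk_symmetric U) \<and> inj_on (\<lambda>e. {tail U e, head U e}) (arcs U)"

text \<open>The fundamental group of a graph of groups whose underlying graph is a tree (so there are no
  stable letters): the free product of the vertex groups, amalgamated along the edge groups.\<close>

definition fg_gens :: "('i, 'j, 'g set) labelled_graph \<Rightarrow> ('i \<times> 'g) set" where
  "fg_gens \<G> = {(x, g). x \<in> verts (ugraph \<G>) \<and> g \<in> vlabel \<G> x}"

definition fg_relators ::
  "('g, 'm) monoid_scheme \<Rightarrow> ('i, 'j, 'g set) labelled_graph \<Rightarrow> ('i \<times> 'g) word set" where
  "fg_relators G \<G> =
    {[((x, g), True), ((x, h), True), ((x, g \<otimes>\<^bsub>G\<^esub> h), False)] | x g h.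
       x \<in> verts (ugraph \<G>) \<and> g \<in> vlabel \<G> x \<and> h \<in> vlabel \<G> x} \<union>
    {[((tail (ugraph \<G>) e, g), True), ((head (ugraph \<G>) e, g), False)] | e g.
       e \<in> arcs (ugraph \<G>) \<and> g \<in> elabel \<G> e}"

definition decomposition ::
  "('g, 'm) monoid_scheme \<Rightarrow> ('i, 'j, 'g set) labelled_graph \<Rightarrow> bool" where
  "decomposition G \<G> \<longleftrightarrow>
    underlying_tree (ugraph \<G>) \<and>
    (\<forall>x\<in>verts (ugraph \<G>). subgroup (vlabel \<G> x) G) \<and>
    (\<forall>e\<in>arcs (ugraph \<G>). subgroup (elabel \<G> e) G \<and>
      elabel \<G> e \<subseteq> vlabel \<G> (tail (ugraph \<G>) e) \<inter> vlabel \<G> (head (ugraph \<G>) e)) \<and>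
    (\<exists>\<psi> \<in> iso (presented_group (fg_gens \<G>) (fg_relators G \<G>)) G.
      \<forall>(x, g)\<in>fg_gens \<G>. \<psi> (presented_gen (fg_gens \<G>) (fg_relators G \<G>) (x, g)) = g)"

text \<open>The vertices of the Bass--Serre tree are the cosets \<open>g G\<^sub>x\<close> of the vertex groups, and the edges
  are the cosets \<open>g G\<^sub>e\<close> of the edge groups, each joining the cosets of \<open>g\<close> at the two ends of \<open>e\<close>.\<close>

definition bass_serre_tree ::
  "('g, 'm) monoid_scheme \<Rightarrow> ('i, 'j, 'g set) labelled_graph \<Rightarrow> ('i \<times> 'g set) pair_pre_digraph"
  where
  "bass_serre_tree G \<G> =
    (let A = {((tail (ugraph \<G>) e, g <#\<^bsub>G\<^esub> vlabel \<G> (tail (ugraph \<G>) e)),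
               (head (ugraph \<G>) e, g <#\<^bsub>G\<^esub> vlabel \<G> (head (ugraph \<G>) e))) | e g.
               e \<in> arcs (ugraph \<G>) \<and> g \<in> carrier G}
     in \<lparr>pverts = {(x, g <#\<^bsub>G\<^esub> vlabel \<G> x) | x g. x \<in> verts (ugraph \<G>) \<and> g \<in> carrier G},
         parcs = A \<union> A\<inverse>\<rparr>)"

definition bass_serre_action ::
  "('g, 'm) monoid_scheme \<Rightarrow> ('i, 'j, 'g set) labelled_graph \<Rightarrow> 'g \<Rightarrow> 'i \<times> 'g set \<Rightarrow> 'i \<times> 'g set"
  where
  "bass_serre_action G \<G> g =
    restrict (\<lambda>(x, C). (x, g <#\<^bsub>G\<^esub> C)) (pverts (bass_serre_tree G \<G>))"

definition vertex_elliptic_abelian_JSJ ::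
  "'t itself \<Rightarrow> 'v pair_pre_digraph \<Rightarrow> ('i, 'j, 'v word set set) labelled_graph \<Rightarrow> bool" where
  "vertex_elliptic_abelian_JSJ ty \<Gamma> \<G> \<longleftrightarrow>
    decomposition (raag \<Gamma>) \<G> \<and>
    (let T = bass_serre_tree (raag \<Gamma>) \<G>; \<phi> = bass_serre_action (raag \<Gamma>) \<G> in
      AH_tree \<Gamma> T \<phi> \<and>
      universally_elliptic ty \<Gamma> T \<phi> \<and>
      (\<forall>(T' :: 't pair_pre_digraph) \<phi>'. universally_elliptic ty \<Gamma> T' \<phi>' \<longrightarrow>
        dominates (raag \<Gamma>) T \<phi> T' \<phi>'))"


section \<open>The iterated separating-clique construction\<close>

text \<open>A splitting records for each vertex the vertex set of the subgraph whose group sits there, and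
  for each edge the clique whose group sits there. Vertices and edges are named by natural numbers;
  the names are immaterial.\<close>

type_synonym 'v splitting = "(nat, nat, 'v set) labelled_graph"

definition graph_of_groups ::
  "'v pair_pre_digraph \<Rightarrow> 'v splitting \<Rightarrow> (nat, nat, 'v word set set) labelled_graph" where
  "graph_of_groups \<Gamma> \<Lambda> =
    \<lparr>ugraph = ugraph \<Lambda>,
     vlabel = (\<lambda>x. raag_sub \<Gamma> (vlabel \<Lambda> x)),
     elabel = (\<lambda>e. raag_sub \<Gamma> (elabel \<Lambda> e))\<rparr>"

definition trivial_splitting :: "'v set \<Rightarrow> 'v splitting \<Rightarrow> bool" where
  "trivial_splitting S \<Lambda> \<longleftrightarrow>
    (\<exists>x. verts (ugraph \<Lambda>) = {x} \<and> arcs (ugraph \<Lambda>) = {} \<and> vlabel \<Lambda> x = S)"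

definition star_splitting ::
  "'v pair_pre_digraph \<Rightarrow> 'v set \<Rightarrow> 'v set \<Rightarrow> 'v splitting \<Rightarrow> bool" where
  "star_splitting \<Gamma> S K \<Lambda> \<longleftrightarrow>
    (let U = ugraph \<Lambda>; \<C> = components \<Gamma> (S - K) in
      \<exists>c leaf edge.
        inj_on leaf \<C> \<and> c \<notin> leaf ` \<C> \<and> inj_on edge \<C> \<and>
        verts U = insert c (leaf ` \<C>) \<and> arcs U = edge ` \<C> \<and>
        vlabel \<Lambda> c = K \<and>
        (\<forall>D\<in>\<C>. vlabel \<Lambda> (leaf D) = D \<union> K \<and> elabel \<Lambda> (edge D) = K \<and>
          tail U (edge D) = c \<and> head U (edge D) = leaf D))"

definition one_edge_splitting ::
  "'v pair_pre_digraph \<Rightarrow> 'v set \<Rightarrow> 'v set \<Rightarrow> 'v splitting \<Rightarrow> bool" where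
  "one_edge_splitting \<Gamma> S K \<Lambda> \<longleftrightarrow>
    (let U = ugraph \<Lambda> in
      \<exists>D1 D2 x1 x2 e.
        components \<Gamma> (S - K) = {D1, D2} \<and> D1 \<noteq> D2 \<and> x1 \<noteq> x2 \<and>
        verts U = {x1, x2} \<and> arcs U = {e} \<and> tail U e = x1 \<and> head U e = x2 \<and>
        vlabel \<Lambda> x1 = D1 \<union> K \<and> vlabel \<Lambda> x2 = D2 \<union> K \<and> elabel \<Lambda> e = K)"

definition clique_splitting ::
  "'v pair_pre_digraph \<Rightarrow> 'v set \<Rightarrow> 'v set \<Rightarrow> 'v splitting \<Rightarrow> bool" where
  "clique_splitting \<Gamma> S K \<Lambda> \<longleftrightarrow>
    min_separating_clique \<Gamma> S K \<and> (star_splitting \<Gamma> S K \<Lambda> \<or> one_edge_splitting \<Gamma> S K \<Lambda>)"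

text \<open>\<open>replace_vertex \<Lambda> x M \<Lambda>'\<close>: \<open>\<Lambda>'\<close> arises from \<open>\<Lambda>\<close> by replacing the vertex \<open>x\<close> by \<open>M\<close>, a splitting of
  the group at \<open>x\<close>. Each end at \<open>x\<close> of an edge with clique \<open>C\<close> is reattached to some vertex of \<open>M\<close>
  whose subgraph contains \<open>C\<close>.\<close>

definition replace_vertex ::
  "'v splitting \<Rightarrow> nat \<Rightarrow> 'v splitting \<Rightarrow> 'v splitting \<Rightarrow> bool" where
  "replace_vertex \<Lambda> x M \<Lambda>' \<longleftrightarrow>
    (let U = ugraph \<Lambda>; W = ugraph M; U' = ugraph \<Lambda>';
         reattached = (\<lambda>e y y'. if y = x then y' \<in> verts W \<and> elabel \<Lambda> e \<subseteq> vlabel M y' else y' = y)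
     in
      x \<in> verts U \<and> (verts U - {x}) \<inter> verts W = {} \<and> arcs U \<inter> arcs W = {} \<and>
      verts U' = (verts U - {x}) \<union> verts W \<and> arcs U' = arcs U \<union> arcs W \<and>
      (\<forall>y\<in>verts U - {x}. vlabel \<Lambda>' y = vlabel \<Lambda> y) \<and>
      (\<forall>y\<in>verts W. vlabel \<Lambda>' y = vlabel M y) \<and>
      (\<forall>e\<in>arcs U. elabel \<Lambda>' e = elabel \<Lambda> e \<and>
        reattached e (tail U e) (tail U' e) \<and> reattached e (head U e) (head U' e)) \<and>
      (\<forall>e\<in>arcs W. elabel \<Lambda>' e = elabel M e \<and> tail U' e = tail W e \<and> head U' e = head W e))"

text \<open>\<open>process \<Gamma> S Ks \<Lambda>\<close>: \<open>\<Lambda>\<close> is obtained from the trivial splitting of \<open>A(S)\<close> by processing the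
  cliques in \<open>Ks\<close> from left to right.\<close>

inductive process :: "'v pair_pre_digraph \<Rightarrow> 'v set \<Rightarrow> 'v set list \<Rightarrow> 'v splitting \<Rightarrow> bool"
  for \<Gamma> :: "'v pair_pre_digraph" and S :: "'v set" where
  Nil: "trivial_splitting S \<Lambda> \<Longrightarrow> process \<Gamma> S [] \<Lambda>"
| snoc: "\<lbrakk>process \<Gamma> S Ks \<Lambda>; x \<in> verts (ugraph \<Lambda>); separating_clique \<Gamma> (vlabel \<Lambda> x) K;
    clique_splitting \<Gamma> (vlabel \<Lambda> x) K M; replace_vertex \<Lambda> x M \<Lambda>'\<rbrakk>
    \<Longrightarrow> process \<Gamma> S (Ks @ [K]) \<Lambda>'"

definition min_clique_refinement ::
  "'v pair_pre_digraph \<Rightarrow> 'v set \<Rightarrow> 'v splitting \<Rightarrow> bool" where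
  "min_clique_refinement \<Gamma> S \<Lambda> \<longleftrightarrow>
    (\<exists>Ks. distinct Ks \<and> set Ks = {K. min_separating_clique \<Gamma> S K} \<and> process \<Gamma> S Ks \<Lambda>)"

text \<open>The vertices of a splitting are refined one at a time and in any order. Refining one of them
  does not affect the subgraphs at the others.\<close>

inductive iterated_splitting :: "'v pair_pre_digraph \<Rightarrow> 'v splitting \<Rightarrow> bool"
  for \<Gamma> :: "'v pair_pre_digraph" where
  start: "trivial_splitting (pverts \<Gamma>) \<Lambda> \<Longrightarrow> iterated_splitting \<Gamma> \<Lambda>"
| refine: "\<lbrakk>iterated_splitting \<Gamma> \<Lambda>; x \<in> verts (ugraph \<Lambda>);
    \<exists>K. separating_clique \<Gamma> (vlabel \<Lambda> x) K;
    min_clique_refinement \<Gamma> (vlabel \<Lambda> x) M; replace_vertex \<Lambda> x M \<Lambda>'\<rbrakk>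
    \<Longrightarrow> iterated_splitting \<Gamma> \<Lambda>'"

definition separating_clique_construction ::
  "'v pair_pre_digraph \<Rightarrow> 'v splitting \<Rightarrow> bool" where
  "separating_clique_construction \<Gamma> \<Lambda> \<longleftrightarrow>
    iterated_splitting \<Gamma> \<Lambda> \<and>
    (\<forall>x\<in>verts (ugraph \<Lambda>). Digraph_Component.connected (with_proj \<Gamma> \<restriction> vlabel \<Lambda> x) \<and>
      \<not> (\<exists>K. separating_clique \<Gamma> (vlabel \<Lambda> x) K))"

end

theory Submission
  imports Defs "HOL-Algebra.Sym_Groups"
begin

text \<open>The construction is tracked by a single invariant: a splitting that it produces is a tree
  decomposition of \<open>\<Gamma>\<close> (\<open>tree_decomposition\<close>). Its underlying graph is a tree, every edge of \<open>\<Gamma>\<close> lies in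
  the subgraph at some vertex, the places where a given vertex of \<open>\<Gamma>\<close> occurs form a subtree, and the
  edges carry cliques. Splitting along a clique produces such a decomposition, and replacing a vertex
  by a tree decomposition of its subgraph preserves the invariant.

  The invariant makes the splitting a decomposition of \<open>A(\<Gamma>)\<close> (\<open>tree_decomposition_decomposition\<close>): a
  generator \<open>v\<close> can be sent to its copy at any place where it occurs, because these places are connected
  by edges whose groups contain \<open>v\<close>, and the commutation relation of an edge of \<open>\<Gamma>\<close> holds inside one
  vertex group.

  That the Bass--Serre graph is a tree is shown without normal forms. By the universal property of the
  fundamental group, each edge \<open>e\<close> of the underlying tree determines a cocycle with values in the
  integer functions on \<open>G\<close> (\<open>wall_cocycle_exists\<close>). From it one reads off a function on the vertices of
  the Bass--Serre graph that changes across one given edge and across no other (\<open>B_halfspace\<close>), so each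
  edge separates. The same cocycle shows that neighbouring vertex groups meet exactly in the edge
  group, which identifies the edge stabilizers with the conjugates of the groups \<open>A(C)\<close> of cliques \<open>C\<close>.

  Universal ellipticity and domination both follow from one fact (\<open>AH_tree_elliptic\<close>): if the
  subgraph induced by \<open>S\<close> has no separating clique, then \<open>A(S)\<close> is elliptic in every
  \<open>(\<A>, \<H>)\<close>-tree. Indeed, the generators in \<open>S\<close> that fix an edge of the tree lie in an abelian group,
  so they form a clique \<open>K\<close>, and \<open>S - K\<close> is connected. Each generator in \<open>S - K\<close> has its fixed points on
  one side of the edge, and adjacent generators commute, so they have a common fixed point. Hence all
  of \<open>S - K\<close> lies on the same side. Every edge that is not fixed by all of \<open>S\<close> thus points to a side,
  and moving in the direction to which the edges point leads to a common fixed point. A clique has no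
  separating clique, which gives the edge stabilizers; the construction stops when the subgraphs at the
  vertices have none, which gives the vertex stabilizers.\<close>

section \<open>Groups given by presentations\<close>

lemma word_eq_words:
  assumes "word_eq S R v w"
  shows "v \<in> words S" "w \<in> words S"
  using assms by induction auto

lemma word_eq_append:
  assumes "word_eq S R v w" "x \<in> words S" "y \<in> words S"
  shows "word_eq S R (x @ v @ y) (x @ w @ y)"
  using assms
proof induction
  case (refl w)
  then show ?case by (intro word_eq.refl) auto
next
  case (cancel u s b w)
  then show ?case using word_eq.cancel[of "x @ u" s b "w @ y" S R] by auto
next
  case (relator r u w)
  then show ?case using word_eq.relator[of r R "x @ u" "w @ y" S] by auto
qed (blast intro: word_eq.sym word_eq.trans)+

lemma word_eq_cong:
  assumes "word_eq S R v v'" "word_eq S R w w'"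
  shows "word_eq S R (v @ w) (v' @ w')"
proof -
  have "word_eq S R (v @ w) (v' @ w)"
    using word_eq_append[OF assms(1), of "[]" w] word_eq_words[OF assms(2)] by simp
  moreover have "word_eq S R (v' @ w) (v' @ w')"
    using word_eq_append[OF assms(2), of v' "[]"] word_eq_words[OF assms(1)] by simp
  ultimately show ?thesis by (rule word_eq.trans)
qed

lemma word_class_eq_iff:
  assumes "w \<in> words S"
  shows "word_class S R v = word_class S R w \<longleftrightarrow> word_eq S R v w"
proof
  assume "word_class S R v = word_class S R w"
  moreover have "w \<in> word_class S R w"
    by (simp add: word_class_def word_eq.refl assms)
  ultimately show "word_eq S R v w" by (auto simp: word_class_def)
qed (auto simp: word_class_def intro: word_eq.sym word_eq.trans)

lemma presented_group_mult:
  assumes "v \<in> words S" "w \<in> words S"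
  shows "word_class S R v \<otimes>\<^bsub>presented_group S R\<^esub> word_class S R w = word_class S R (v @ w)"
proof -
  have "word_class S R (x @ y) = word_class S R (v @ w)"
    if "x \<in> word_class S R v" "y \<in> word_class S R w" for x y
    using that assms word_eq_cong[of S R v x w y]
    by (subst word_class_eq_iff) (auto simp: word_class_def intro: word_eq.sym)
  moreover have "v \<in> word_class S R v" "w \<in> word_class S R w"
    using assms by (auto simp: word_class_def word_eq.refl)
  ultimately have "(\<Union>x\<in>word_class S R v. \<Union>y\<in>word_class S R w. word_class S R (x @ y)) =
      word_class S R (v @ w)"
    by blast
  then show ?thesis by (simp add: presented_group_def)
qed

lemma presented_group_carrier: "carrier (presented_group S R) = word_class S R ` words S"
  by (simp add: presented_group_def)

lemma presented_group_one: "\<one>\<^bsub>presented_group S R\<^esub> = word_class S R []"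
  by (simp add: presented_group_def)

abbreviation inverse_word :: "'s word \<Rightarrow> 's word" where
  "inverse_word w \<equiv> rev (map (\<lambda>(s, b). (s, \<not> b)) w)"

lemma inverse_word_in_words: "w \<in> words S \<Longrightarrow> inverse_word w \<in> words S"
  by auto

lemma word_eq_inverse_word:
  assumes "w \<in> words S"
  shows "word_eq S R (inverse_word w @ w) []"
  using assms
proof (induction w)
  case (Cons x w)
  obtain s b where x: "x = (s, b)" by (cases x)
  have "word_eq S R (inverse_word w @ [(s, \<not> b), (s, \<not> \<not> b)] @ w) (inverse_word w @ w)"
    using Cons.hyps x by (intro word_eq.cancel) auto
  with Cons x show ?case by (auto intro: word_eq.trans)
qed (simp add: word_eq.refl)

lemma group_presented_group: "group (presented_group S R)"
proof (rule groupI)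
  fix X assume "X \<in> carrier (presented_group S R)"
  then obtain w where w: "w \<in> words S" "X = word_class S R w"
    by (auto simp: presented_group_carrier)
  have "word_class S R (inverse_word w) \<otimes>\<^bsub>presented_group S R\<^esub> X = \<one>\<^bsub>presented_group S R\<^esub>"
    using w word_eq_inverse_word[OF w(1)] inverse_word_in_words[OF w(1)]
    by (simp add: presented_group_mult presented_group_one word_class_eq_iff)
  then show "\<exists>Y\<in>carrier (presented_group S R).
      Y \<otimes>\<^bsub>presented_group S R\<^esub> X = \<one>\<^bsub>presented_group S R\<^esub>"
    using inverse_word_in_words[OF w(1)] by (auto simp: presented_group_carrier)
  show "\<one>\<^bsub>presented_group S R\<^esub> \<otimes>\<^bsub>presented_group S R\<^esub> X = X"
    using w presented_group_mult[of "[]" S w R] by (simp add: presented_group_one)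
next
  fix X Y assume "X \<in> carrier (presented_group S R)" "Y \<in> carrier (presented_group S R)"
  then obtain v w where "v \<in> words S" "X = word_class S R v" "w \<in> words S" "Y = word_class S R w"
    by (auto simp: presented_group_carrier)
  then show "X \<otimes>\<^bsub>presented_group S R\<^esub> Y \<in> carrier (presented_group S R)"
    by (auto simp: presented_group_mult presented_group_carrier)
next
  fix X Y Z
  assume "X \<in> carrier (presented_group S R)" "Y \<in> carrier (presented_group S R)"
    "Z \<in> carrier (presented_group S R)"
  then obtain u v w where "u \<in> words S" "X = word_class S R u" "v \<in> words S" "Y = word_class S R v"
    "w \<in> words S" "Z = word_class S R w"
    by (auto simp: presented_group_carrier)
  then show "X \<otimes>\<^bsub>presented_group S R\<^esub> Y \<otimes>\<^bsub>presented_group S R\<^esub> Z =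
      X \<otimes>\<^bsub>presented_group S R\<^esub> (Y \<otimes>\<^bsub>presented_group S R\<^esub> Z)"
    using presented_group_mult[of "u @ v" S w R] presented_group_mult[of u S "v @ w" R]
    by (simp add: presented_group_mult)
qed (auto simp: presented_group_one presented_group_carrier)

lemma presented_gen_closed: "s \<in> S \<Longrightarrow> presented_gen S R s \<in> carrier (presented_group S R)"
  by (auto simp: presented_gen_def presented_group_carrier)

lemma inv_presented_gen:
  assumes "s \<in> S"
  shows "inv\<^bsub>presented_group S R\<^esub> (presented_gen S R s) = word_class S R [(s, False)]"
proof -
  interpret group "presented_group S R" by (rule group_presented_group)
  have "word_eq S R ([] @ [(s, False), (s, \<not> False)] @ []) ([] @ [])"
    using assms by (intro word_eq.cancel) auto
  then have "word_class S R [(s, False)] \<otimes>\<^bsub>presented_group S R\<^esub> presented_gen S R s =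
      \<one>\<^bsub>presented_group S R\<^esub>"
    using assms by (simp add: presented_group_mult presented_gen_def presented_group_one
        word_class_eq_iff)
  then show ?thesis
    using assms by (intro inv_equality presented_gen_closed) (auto simp: presented_group_carrier)
qed

primrec word_val :: "('h, 'm) monoid_scheme \<Rightarrow> ('s \<Rightarrow> 'h) \<Rightarrow> 's word \<Rightarrow> 'h" where
  "word_val H f [] = \<one>\<^bsub>H\<^esub>"
| "word_val H f (x # w) =
    (if snd x then f (fst x) else inv\<^bsub>H\<^esub> (f (fst x))) \<otimes>\<^bsub>H\<^esub> word_val H f w"

lemma (in group) word_val_closed:
  assumes "f \<in> S \<rightarrow> carrier G" "w \<in> words S"
  shows "word_val G f w \<in> carrier G"
  using assms(2) by induction (use funcset_mem[OF assms(1)] in \<open>simp_all add: mem_Times_iff\<close>)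

lemma (in group) word_val_append:
  assumes f: "f \<in> S \<rightarrow> carrier G" and "v \<in> words S" and w: "w \<in> words S"
  shows "word_val G f (v @ w) = word_val G f v \<otimes> word_val G f w"
  using assms(2)
proof induction
  case (Cons x v)
  then have "f (fst x) \<in> carrier G" using funcset_mem[OF f] by (simp add: mem_Times_iff)
  then show ?case
    using Cons word_val_closed[OF f w] word_val_closed[OF f Cons.hyps(2)] by (simp add: m_assoc)
qed (use word_val_closed[OF f w] in simp)

lemma word_val_presented_gen:
  assumes "w \<in> words S"
  shows "word_val (presented_group S R) (presented_gen S R) w = word_class S R w"
  using assms
proof induction
  case (Cons x w)
  obtain s b where x: "x = (s, b)" by (cases x)
  with Cons have s: "s \<in> S" by simp
  have "(if b then presented_gen S R s else inv\<^bsub>presented_group S R\<^esub> (presented_gen S R s)) =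
      word_class S R [(s, b)]"
    by (cases b) (simp_all only: if_True if_False inv_presented_gen[OF s], simp add: presented_gen_def)
  moreover have "word_class S R [(s, b)] \<otimes>\<^bsub>presented_group S R\<^esub> word_class S R w =
      word_class S R ([(s, b)] @ w)"
    by (rule presented_group_mult) (use s Cons.hyps in auto)
  ultimately show ?case by (simp only: x word_val.simps fst_conv snd_conv Cons.IH append.simps)
qed (simp add: presented_group_one)

lemma word_val_relator:
  assumes "r \<in> R" "r \<in> words S"
  shows "word_val (presented_group S R) (presented_gen S R) r = \<one>\<^bsub>presented_group S R\<^esub>"
  using assms word_eq.relator[of r R "[]" "[]" S]
  by (simp add: word_val_presented_gen presented_group_one word_class_eq_iff)

lemma (in group) word_val_word_eq:
  assumes f: "f \<in> S \<rightarrow> carrier G"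
    and R: "\<And>r. r \<in> R \<Longrightarrow> r \<in> words S \<Longrightarrow> word_val G f r = \<one>"
    and "word_eq S R v w"
  shows "word_val G f v = word_val G f w"
  using assms(3)
proof induction
  case (cancel u s b w)
  then have uw: "u \<in> words S" "w \<in> words S" "s \<in> S" by auto
  have "f s \<in> carrier G" using funcset_mem[OF f uw(3)] .
  then have "word_val G f ([(s, b), (s, \<not> b)] @ w) = word_val G f w"
    using word_val_closed[OF f uw(2)] by (cases b) (simp_all flip: m_assoc)
  moreover have "[(s, b), (s, \<not> b)] @ w \<in> words S" using uw by simp
  ultimately show ?case
    using word_val_append[OF f uw(1)] uw(2) by metis
next
  case (relator r u w)
  then show ?case
    using word_val_closed[OF f] by (simp add: word_val_append[OF f] R)
qed auto

text \<open>Von Dyck's theorem: if the relators have value \<open>\<one>\<close>, then the value of a word is invariant under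
  \<^const>\<open>word_eq\<close>.\<close>

lemma (in group) presented_group_hom_exists:
  assumes f: "f \<in> S \<rightarrow> carrier G"
    and R: "\<And>r. r \<in> R \<Longrightarrow> r \<in> words S \<Longrightarrow> word_val G f r = \<one>"
  shows "\<exists>h\<in>hom (presented_group S R) G. \<forall>s\<in>S. h (presented_gen S R s) = f s"
proof -
  \<comment> \<open>Equivalent words have the same value, so the choice of the representative does not matter.\<close>
  define h where "h = (\<lambda>X. word_val G f (SOME w. w \<in> X))"
  have h: "h (word_class S R w) = word_val G f w" if "w \<in> words S" for w
  proof -
    have "w \<in> word_class S R w" using that by (simp add: word_class_def word_eq.refl)
    then have "(SOME w'. w' \<in> word_class S R w) \<in> word_class S R w" by (rule someI)
    then have "word_eq S R w (SOME w'. w' \<in> word_class S R w)" by (simp add: word_class_def)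
    from word_val_word_eq[OF f R this] show ?thesis by (simp add: h_def)
  qed
  have "h \<in> hom (presented_group S R) G"
  proof (rule homI)
    fix X assume "X \<in> carrier (presented_group S R)"
    then show "h X \<in> carrier G"
      using h word_val_closed[OF f] unfolding presented_group_carrier by fastforce
  next
    fix X Y assume "X \<in> carrier (presented_group S R)" "Y \<in> carrier (presented_group S R)"
    then obtain v w where vw: "v \<in> words S" "X = word_class S R v" "w \<in> words S" "Y = word_class S R w"
      unfolding presented_group_carrier by blast
    moreover have "v @ w \<in> words S" using vw by simp
    ultimately show "h (X \<otimes>\<^bsub>presented_group S R\<^esub> Y) = h X \<otimes> h Y"
      by (simp only: presented_group_mult h word_val_append[OF f])
  qed
  moreover have "h (presented_gen S R s) = f s" if "s \<in> S" for s
    using that h[of "[(s, True)]"] funcset_mem[OF f that] by (simp add: presented_gen_def)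
  ultimately show ?thesis by blast
qed

lemma presented_group_generated:
  "generate (presented_group S R) (presented_gen S R ` S) = carrier (presented_group S R)"
proof
  interpret group "presented_group S R" by (rule group_presented_group)
  show "generate (presented_group S R) (presented_gen S R ` S) \<subseteq> carrier (presented_group S R)"
    by (rule generate_incl) (auto intro: presented_gen_closed)
  have "word_val (presented_group S R) (presented_gen S R) w \<in>
      generate (presented_group S R) (presented_gen S R ` S)" if "w \<in> words S" for w
    using that
  proof induction
    case (Cons x w)
    then have "presented_gen S R (fst x) \<in> presented_gen S R ` S" by (simp add: mem_Times_iff)
    with Cons.IH show ?case by (simp add: generate.intros)
  qed (simp add: generate.one)
  then show "carrier (presented_group S R) \<subseteq> generate (presented_group S R) (presented_gen S R ` S)"
    by (force simp: presented_group_carrier word_val_presented_gen)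
qed

lemma hom_eq_on_generate:
  assumes "group G" "group H" "f \<in> hom G H" "h \<in> hom G H" "S \<subseteq> carrier G"
    and eq: "\<And>s. s \<in> S \<Longrightarrow> f s = h s" and "g \<in> generate G S"
  shows "f g = h g"
proof -
  interpret f: group_hom G H f using assms by (simp add: group_hom_def group_hom_axioms_def)
  interpret h: group_hom G H h using assms by (simp add: group_hom_def group_hom_axioms_def)
  show ?thesis
    using assms(7)
  proof induction
    case (eng h1 h2)
    then show ?case using f.G.generate_in_carrier[OF assms(5)] by simp
  qed (use eq assms(5) in auto)
qed

lemma (in group) generate_commute:
  assumes "S \<subseteq> carrier G" and comm: "\<And>s t. s \<in> S \<Longrightarrow> t \<in> S \<Longrightarrow> s \<otimes> t = t \<otimes> s"
    and "g \<in> generate G S" "h \<in> generate G S"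
  shows "g \<otimes> h = h \<otimes> g"
proof -
  have inv_comm: "inv a \<otimes> b = b \<otimes> inv a"
    if "a \<otimes> b = b \<otimes> a" "a \<in> carrier G" "b \<in> carrier G" for a b
  proof -
    have "inv a \<otimes> b = inv a \<otimes> (b \<otimes> a) \<otimes> inv a" using that(2,3) by (simp add: m_assoc)
    also have "\<dots> = inv a \<otimes> (a \<otimes> b) \<otimes> inv a" by (simp only: that(1))
    also have "\<dots> = b \<otimes> inv a" using that(2,3) by (simp flip: m_assoc)
    finally show ?thesis .
  qed
  have mult_comm: "a \<otimes> c \<otimes> b = b \<otimes> (a \<otimes> c)"
    if "a \<otimes> b = b \<otimes> a" "c \<otimes> b = b \<otimes> c" "a \<in> carrier G" "b \<in> carrier G" "c \<in> carrier G" for a b c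
  proof -
    have "a \<otimes> c \<otimes> b = a \<otimes> (b \<otimes> c)" using m_assoc[of a c b] that(2-5) by metis
    also have "\<dots> = b \<otimes> (a \<otimes> c)" using m_assoc[of a b c] m_assoc[of b a c] that(1,3-5) by metis
    finally show ?thesis .
  qed
  note gen = generate_in_carrier[OF assms(1)]
  have "g \<otimes> s = s \<otimes> g" if "s \<in> S" for s
    using assms(3)
  proof induction
    case one
    then show ?case using that assms(1) by auto
  next
    case (eng h1 h2)
    then show ?case using that assms(1) gen mult_comm[of h1 s h2] by auto
  qed (use that assms(1) comm in \<open>auto intro!: inv_comm\<close>)
  then have S: "s \<otimes> g = g \<otimes> s" if "s \<in> S" for s using that by simp
  have "h \<otimes> g = g \<otimes> h"
    using assms(4)
  proof induction
    case one
    then show ?case using gen[OF assms(3)] by auto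
  next
    case (eng h1 h2)
    then show ?case using gen assms(3) mult_comm[of h1 g h2] by auto
  qed (use assms(1) gen[OF assms(3)] S in \<open>auto intro!: inv_comm\<close>)
  then show ?thesis by simp
qed

section \<open>Trees\<close>

lemma pcas_preserves:
  assumes "pcas c p d" and "\<And>x y. (x, y) \<in> set p \<Longrightarrow> x \<in> H \<longleftrightarrow> y \<in> H"
  shows "c \<in> H \<longleftrightarrow> d \<in> H"
  using assms by (induction p arbitrary: c) (auto, blast+)

text \<open>A cycle that leaves a set of vertices along one edge must come back along another one. Conversely,
  if there are no cycles, then removing an edge cuts off what is reachable from one of its ends. In
  this form, being a tree can be verified for a Bass--Serre graph and used for a given tree.\<close>

lemma simplicial_tree_iff_halfspaces:
  "simplicial_tree T \<longleftrightarrow>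
    pair_bidirected_digraph T \<and> Digraph_Component.connected (with_proj T) \<and>
    (\<forall>a b. (a, b) \<in> parcs T \<longrightarrow> (\<exists>H. a \<in> H \<and> b \<notin> H \<and>
      (\<forall>x y. (x, y) \<in> parcs T \<longrightarrow> {x, y} \<noteq> {a, b} \<longrightarrow> (x \<in> H \<longleftrightarrow> y \<in> H))))"
  (is "_ \<longleftrightarrow> _ \<and> _ \<and> ?halfspaces")
proof (cases "pair_bidirected_digraph T")
  case True
  then interpret pair_bidirected_digraph T .
  have "?halfspaces \<longleftrightarrow> \<not> (\<exists>p. cycle p \<and> 3 \<le> length p)"
  proof
    assume halfspaces: ?halfspaces
    show "\<not> (\<exists>p. cycle p \<and> 3 \<le> length p)"
    proof
      assume "\<exists>p. cycle p \<and> 3 \<le> length p"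
      then obtain p u where p: "awalk u p u" "distinct (tl (awalk_verts u p))" "3 \<le> length p"
        by (auto simp: cycle_def)
      then obtain u' a a' c q where pq: "p = (u', a) # (a', c) # q" "q \<noteq> []"
        unfolding numeral_3_eq_3 by (auto simp: Suc_le_length_iff)
      with p(1) have e: "u' = u" "a' = a" "(u, a) \<in> parcs T" "(a, c) \<in> parcs T" "awalk c q u"
        by (auto simp: awalk_Cons_iff)
      have dist: "a \<notin> set (awalk_verts c q)" "distinct (awalk_verts c q)"
        using p(2) pq e by auto
      have "c \<noteq> u"
      proof
        assume "c = u"
        obtain f q' where q: "q = f # q'" using pq(2) by (cases q) auto
        with e(5) have "awalk (snd f) q' u" by (auto simp: awalk_Cons_iff)
        then have "last (pawalk_verts (snd f) q') = u" by (rule awlast_of_awalk) simp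
        then have "u \<in> set (pawalk_verts (snd f) q')"
          using last_in_set[of "pawalk_verts (snd f) q'"] by (simp add: awalk_verts_non_Nil)
        with dist(2) q e(5) \<open>c = u\<close> show False by (auto simp: awalk_Cons_iff)
      qed
      obtain H where H: "u \<in> H" "a \<notin> H"
        "\<forall>x y. (x, y) \<in> parcs T \<longrightarrow> {x, y} \<noteq> {u, a} \<longrightarrow> (x \<in> H \<longleftrightarrow> y \<in> H)"
        using halfspaces[rule_format, OF e(3)] by metis
      have "{a, c} \<noteq> {u, a}" using \<open>c \<noteq> u\<close> no_loops'[OF e(4)] by (auto simp: doubleton_eq_iff)
      with H e(4) have "c \<notin> H" by blast
      moreover have "c \<in> H \<longleftrightarrow> u \<in> H"
      proof (rule pcas_preserves)
        show "pcas c q u" using e(5) by (simp add: awalk_def)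
      next
        fix x y assume xy: "(x, y) \<in> set q"
        then have "x \<in> set (awalk_verts c q)" "y \<in> set (awalk_verts c q)"
          using awalk_verts_arc1[of "(x, y)" q c] awalk_verts_arc2[of c q u "(x, y)"] e(5) by auto
        then have "{x, y} \<noteq> {u, a}" using dist by auto
        moreover have "(x, y) \<in> parcs T" using xy e(5) by auto
        ultimately show "x \<in> H \<longleftrightarrow> y \<in> H" using H(3) by blast
      qed
      ultimately show False using H(1) by simp
    qed
  next
    assume acyclic: "\<not> (\<exists>p. cycle p \<and> 3 \<le> length p)"
    show ?halfspaces
    proof (intro allI impI)
      fix a b assume ab: "(a, b) \<in> parcs T"
      define E where "E = parcs T - {(a, b), (b, a)}"
      let ?H = "{z. (a, z) \<in> E\<^sup>*}"
      have "b \<notin> ?H"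
      proof
        assume "b \<in> ?H"
        interpret E: pair_wf_digraph "\<lparr>pverts = pverts T, parcs = E\<rparr>"
          by unfold_locales (auto simp: E_def dest: in_arcsD1 in_arcsD2)
        have "a \<rightarrow>\<^sup>*\<^bsub>with_proj \<lparr>pverts = pverts T, parcs = E\<rparr>\<^esub> b"
          using \<open>b \<in> ?H\<close> in_arcsD1[OF ab] E.reachable_conv'[of a b] by simp
        then obtain p where p: "E.apath a p b"
          using E.apath_awalk_to_apath by (auto simp: E.reachable_awalk)
        have "awalk a p b" "set p \<subseteq> E"
          using p in_arcsD1[OF ab]
          by (auto simp: pre_digraph.apath_def pre_digraph.awalk_def awalk_def E_def
              cas_with_proj_eq)
        moreover have "distinct (pawalk_verts a p)"
          using p by (simp add: pre_digraph.apath_def awalk_verts_with_proj_eq)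
        moreover have "(b, a) \<in> parcs T" using ab by (rule arcs_symmetric)
        ultimately have "cycle ((b, a) # p)"
          by (auto simp: cycle_def awalk_Cons_iff intro!: exI[of _ b] dest: in_arcsD1)
        moreover have "3 \<le> length ((b, a) # p)"
        proof -
          have "p \<noteq> []" using \<open>awalk a p b\<close> no_loops'[OF ab] by auto
          moreover have "length p \<noteq> 1"
          proof
            assume "length p = 1"
            then obtain e where "p = [e]" by (auto simp: length_Suc_conv)
            with \<open>awalk a p b\<close> have "e = (a, b)" by (auto simp: awalk_Cons_iff prod_eq_iff)
            with \<open>set p \<subseteq> E\<close> \<open>p = [e]\<close> show False by (simp add: E_def)
          qed
          ultimately show ?thesis by (cases p) (auto simp: Suc_le_eq)
        qed
        ultimately show False using acyclic by blast
      qed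
      moreover have "x \<in> ?H \<longleftrightarrow> y \<in> ?H" if "(x, y) \<in> parcs T" "{x, y} \<noteq> {a, b}" for x y
      proof -
        have "(x, y) \<in> E" "(y, x) \<in> E"
          using that arcs_symmetric by (auto simp: E_def)
        then show ?thesis by (auto intro: rtrancl_into_rtrancl)
      qed
      ultimately show "\<exists>H. a \<in> H \<and> b \<notin> H \<and>
          (\<forall>x y. (x, y) \<in> parcs T \<longrightarrow> {x, y} \<noteq> {a, b} \<longrightarrow> (x \<in> H \<longleftrightarrow> y \<in> H))"
        by (intro exI[of _ ?H]) blast
    qed
  qed
  with True show ?thesis by (auto simp: simplicial_tree_def)
qed (simp add: simplicial_tree_def)

lemma connected_with_proj_iff:
  assumes "pair_sym_digraph T"
  shows "Digraph_Component.connected (with_proj T) \<longleftrightarrow>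
    pverts T \<noteq> {} \<and> (\<forall>x\<in>pverts T. \<forall>y\<in>pverts T. (x, y) \<in> (parcs T)\<^sup>*)"
proof -
  interpret pair_sym_digraph T by fact
  have "(\<forall>u\<in>pverts T. \<forall>v\<in>pverts T. u \<rightarrow>\<^sup>*\<^bsub>mk_symmetric (with_proj T)\<^esub> v) \<longleftrightarrow>
      (\<forall>u\<in>pverts T. \<forall>v\<in>pverts T. (u, v) \<in> (parcs T)\<^sup>*)"
    using reachable_mk_symmetric_eq[OF sym_arcs] reachable_conv' by auto
  then show ?thesis
    by (simp add: Digraph_Component.connected_def strongly_connected_def)
qed

text \<open>The halfspace of the edge \<open>a b\<close> on the side of \<open>b\<close>: what is still reachable from \<open>b\<close> after the edge
  has been removed.\<close>

definition side :: "'t pair_pre_digraph \<Rightarrow> 't \<Rightarrow> 't \<Rightarrow> 't set" where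
  "side T a b = {z. (b, z) \<in> (parcs T - {(a, b), (b, a)})\<^sup>*}"

definition setdist :: "'t pair_pre_digraph \<Rightarrow> 't \<Rightarrow> 't set \<Rightarrow> nat" where
  "setdist T x D = (LEAST n. \<exists>d\<in>D. (x, d) \<in> parcs T ^^ n)"

locale tree_graph =
  fixes T :: "'t pair_pre_digraph"
  assumes is_tree: "simplicial_tree T"
begin

sublocale pair_bidirected_digraph T
  using is_tree by (simp add: simplicial_tree_def)

lemma tree_connected: "x \<in> pverts T \<Longrightarrow> y \<in> pverts T \<Longrightarrow> (x, y) \<in> (parcs T)\<^sup>*"
  and tree_nonempty: "pverts T \<noteq> {}"
  using is_tree connected_with_proj_iff[OF pair_sym_digraph_axioms]
  by (auto simp: simplicial_tree_def)

lemma near_end_in_side: "b \<in> side T a b"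
  by (simp add: side_def)

lemma arc_preserves_side:
  assumes "(x, y) \<in> parcs T" "{x, y} \<noteq> {a, b}"
  shows "x \<in> side T a b \<longleftrightarrow> y \<in> side T a b"
proof -
  have "(x, y) \<in> parcs T - {(a, b), (b, a)}" "(y, x) \<in> parcs T - {(a, b), (b, a)}"
    using assms arcs_symmetric by auto
  then show ?thesis unfolding side_def by (auto intro: rtrancl_into_rtrancl)
qed

lemma far_end_not_in_side:
  assumes "(a, b) \<in> parcs T"
  shows "a \<notin> side T a b"
proof
  assume "a \<in> side T a b"
  then have ba: "(b, a) \<in> (parcs T - {(a, b), (b, a)})\<^sup>*" by (simp add: side_def)
  obtain H where H: "a \<in> H" "b \<notin> H"
    "\<forall>x y. (x, y) \<in> parcs T \<longrightarrow> {x, y} \<noteq> {a, b} \<longrightarrow> (x \<in> H \<longleftrightarrow> y \<in> H)"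
    using is_tree[unfolded simplicial_tree_iff_halfspaces] assms by metis
  from ba have "b \<in> H \<longleftrightarrow> a \<in> H"
  proof induction
    case (step y z)
    then have "{y, z} \<noteq> {a, b}" by (auto simp: doubleton_eq_iff)
    with step H(3) show ?case by auto
  qed simp
  with H show False by simp
qed

text \<open>The halfspace of \<open>x y\<close> avoids \<open>x\<close>, so it is connected by edges that the removal of \<open>x y'\<close> leaves
  intact; and \<open>y\<close> itself is still joined to \<open>x\<close> when \<open>x y'\<close> is removed.\<close>

lemma sides_disjoint:
  assumes "(x, y) \<in> parcs T" "(x, y') \<in> parcs T" "y \<noteq> y'"
  shows "side T x y \<inter> side T x y' = {}"
proof -
  have "z \<notin> side T x y'" if "(y, z) \<in> (parcs T - {(x, y), (y, x)})\<^sup>*" for z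
    using that
  proof induction
    case base
    then show ?case
      using arc_preserves_side[OF assms(1), of x y'] far_end_not_in_side[OF assms(2)] assms(3)
      by (auto simp: doubleton_eq_iff)
  next
    case (step z w)
    have "z \<noteq> x" 
      using step.hyps(1) far_end_not_in_side[OF assms(1)] by (auto simp: side_def)
    moreover have "w \<noteq> x"
      using rtrancl_into_rtrancl[OF step.hyps] far_end_not_in_side[OF assms(1)] by (auto simp: side_def)
    ultimately show ?case
      using step arc_preserves_side[of z w x y'] by auto
  qed
  then show ?thesis by (auto simp: side_def)
qed

lemma opposite_sides_disjoint:
  assumes "(a, b) \<in> parcs T"
  shows "side T a b \<inter> side T b a = {}"
proof -
  have "z \<notin> side T a b" if "(a, z) \<in> (parcs T - {(b, a), (a, b)})\<^sup>*" for z
    using that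
  proof induction
    case (step y z)
    then have "{y, z} \<noteq> {a, b}" by (auto simp: doubleton_eq_iff)
    with step arc_preserves_side[of y z a b] show ?case by auto
  qed (rule far_end_not_in_side[OF assms])
  then show ?thesis by (auto simp: side_def)
qed

text \<open>Only one edge leads out of the halfspace, so \<open>a\<close> lies on the walk and is strictly closer to its end
  \<open>d\<close>.\<close>

lemma walk_leaves_side:
  assumes "(p, d) \<in> parcs T ^^ n" "p \<in> side T a b" "d \<notin> side T a b"
  obtains k where "k < n" "(a, d) \<in> parcs T ^^ k"
proof -
  have "\<exists>k<n. (a, d) \<in> parcs T ^^ k"
    using assms
  proof (induction n arbitrary: p)
    case (Suc n)
    from Suc.prems(1) obtain q where q: "(p, q) \<in> parcs T" "(q, d) \<in> parcs T ^^ n"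
      by (blast dest: relpow_Suc_D2)
    show ?case
    proof (cases "q \<in> side T a b")
      case True
      then show ?thesis using Suc.IH[OF q(2)] Suc.prems(3) less_SucI by blast
    next
      case False
      then have "{p, q} = {a, b}" using arc_preserves_side[OF q(1)] Suc.prems(2) by blast
      with False have "q = a" using near_end_in_side by (auto simp: doubleton_eq_iff)
      with q show ?thesis by blast
    qed
  qed simp
  with that show thesis by blast
qed

lemma setdist_attained:
  assumes "x \<in> pverts T" "D \<subseteq> pverts T" "D \<noteq> {}"
  obtains d where "d \<in> D" "(x, d) \<in> parcs T ^^ setdist T x D"
proof -
  obtain d where "d \<in> D" "d \<in> pverts T" using assms by blast
  then have "\<exists>n. \<exists>d\<in>D. (x, d) \<in> parcs T ^^ n"
    using tree_connected[OF assms(1)] by (meson rtrancl_power)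
  then have "\<exists>d\<in>D. (x, d) \<in> parcs T ^^ setdist T x D"
    unfolding setdist_def by (rule LeastI_ex)
  with that show thesis by blast
qed

lemma setdist_le: "d \<in> D \<Longrightarrow> (x, d) \<in> parcs T ^^ n \<Longrightarrow> setdist T x D \<le> n"
  unfolding setdist_def by (rule Least_le) blast

lemma setdist_zero: "x \<in> D \<Longrightarrow> setdist T x D = 0"
  using setdist_le[of x D x 0] by simp

text \<open>The first step of a shortest walk from \<open>x\<close> to \<open>D\<close>: a walk that came back across its first edge could
  be shortened.\<close>

lemma step_towards:
  assumes "x \<in> pverts T" "x \<notin> D" "D \<subseteq> pverts T" "D \<noteq> {}"
  obtains y d where "(x, y) \<in> parcs T" "d \<in> D" "d \<in> side T x y" "setdist T y D < setdist T x D"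
proof -
  obtain d where d: "d \<in> D" "(x, d) \<in> parcs T ^^ setdist T x D"
    using setdist_attained assms by blast
  with assms(2) have "setdist T x D \<noteq> 0" by (metis relpow_0_E)
  then obtain n where n: "setdist T x D = Suc n" using not0_implies_Suc by blast
  with d(2) obtain y where y: "(x, y) \<in> parcs T" "(y, d) \<in> parcs T ^^ n"
    by (metis relpow_Suc_D2)
  have "d \<in> side T x y"
  proof (rule ccontr)
    assume "d \<notin> side T x y"
    with y(2) obtain k where "k < n" "(x, d) \<in> parcs T ^^ k"
      using walk_leaves_side near_end_in_side by metis
    with setdist_le[OF d(1)] n show False by fastforce
  qed
  moreover have "setdist T y D < setdist T x D" using setdist_le[OF d(1) y(2)] n by simp
  ultimately show thesis using that y(1) d(1) by blast
qed

lemma setdist_decreases: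
  assumes "(x, y) \<in> parcs T" "D \<subseteq> pverts T" "D \<noteq> {}" "D \<subseteq> side T x y"
  shows "setdist T y D < setdist T x D"
proof -
  obtain d where d: "d \<in> D" "(x, d) \<in> parcs T ^^ setdist T x D"
    using setdist_attained[OF in_arcsD1[OF assms(1)] assms(2,3)] .
  with assms opposite_sides_disjoint[OF assms(1)] have "d \<notin> side T y x" by blast
  with d(2) near_end_in_side obtain k where "k < setdist T x D" "(y, d) \<in> parcs T ^^ k"
    by (rule walk_leaves_side)
  with setdist_le[OF d(1)] show ?thesis by fastforce
qed

end

section \<open>Elliptic elements of groups acting on trees\<close>

locale group_on_tree = group G + tree_graph T
  for G :: "('g, 'm) monoid_scheme" (structure) and T :: "'t pair_pre_digraph" and \<phi> +
  assumes is_tree_action: "tree_action G T \<phi>"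
begin

sublocale group_action G "pverts T" \<phi>
  using is_tree_action by (simp add: tree_action_def)

lemma act_arc: "g \<in> carrier G \<Longrightarrow> (x, y) \<in> parcs T \<Longrightarrow> (\<phi> g x, \<phi> g y) \<in> parcs T"
  using is_tree_action by (auto simp: tree_action_def)

lemma act_eq_iff:
  assumes "g \<in> carrier G" "x \<in> pverts T" "y \<in> pverts T"
  shows "\<phi> g x = \<phi> g y \<longleftrightarrow> x = y"
  using inj_prop[OF assms(1)] assms by (simp add: inj_on_eq_iff)

definition fixpoints :: "'g \<Rightarrow> 't set" where
  "fixpoints g = {x \<in> pverts T. \<phi> g x = x}"

lemma act_side:
  assumes "g \<in> carrier G" "(a, b) \<in> parcs T" "z \<in> side T a b"
  shows "\<phi> g z \<in> side T (\<phi> g a) (\<phi> g b)"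
proof -
  have "(b, z) \<in> (parcs T - {(a, b), (b, a)})\<^sup>*" using assms(3) by (simp add: side_def)
  then have "(\<phi> g b, \<phi> g z) \<in> (parcs T - {(\<phi> g a, \<phi> g b), (\<phi> g b, \<phi> g a)})\<^sup>*"
  proof induction
    case (step y z)
    then have "(\<phi> g y, \<phi> g z) \<in> parcs T - {(\<phi> g a, \<phi> g b), (\<phi> g b, \<phi> g a)}"
      using act_arc[OF assms(1)] act_eq_iff[OF assms(1)] in_arcsD1 in_arcsD2 assms(2) by auto
    with step.IH show ?case by (rule rtrancl_into_rtrancl)
  qed simp
  then show ?thesis by (simp add: side_def)
qed

text \<open>Convexity of fixed point sets: if \<open>g\<close> moves the first edge of the path from \<open>y\<close> to \<open>z\<close> while fixing
  \<open>y\<close>, then the halfspaces of this edge and of its image are disjoint, yet both contain \<open>z = g z\<close>.\<close>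

lemma fixpoints_convex:
  assumes g: "g \<in> carrier G" and ab: "(a, b) \<in> parcs T"
    and "y \<in> fixpoints g" "y \<notin> side T a b" and z: "z \<in> fixpoints g" "z \<in> side T a b"
  shows "a \<in> fixpoints g \<and> b \<in> fixpoints g"
  using assms(3,4)
proof (induction "setdist T y {z}" arbitrary: y rule: less_induct)
  case less
  have y: "y \<in> pverts T" "\<phi> g y = y" "z \<in> pverts T" "\<phi> g z = z"
    using less.prems z by (auto simp: fixpoints_def)
  have "y \<noteq> z" using less.prems z by auto
  with y obtain w where w: "(y, w) \<in> parcs T" "z \<in> side T y w" "setdist T w {z} < setdist T y {z}"
    using step_towards[of y "{z}"] by auto
  have "\<phi> g w = w"
  proof (rule ccontr)
    assume "\<phi> g w \<noteq> w"
    moreover have "(y, \<phi> g w) \<in> parcs T" using act_arc[OF g w(1)] y by simp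
    ultimately have "side T y w \<inter> side T y (\<phi> g w) = {}" using sides_disjoint[OF w(1)] by metis
    moreover have "z \<in> side T y (\<phi> g w)" using act_side[OF g w(1,2)] y by simp
    ultimately show False using w(2) by blast
  qed
  then have wfix: "w \<in> fixpoints g" using w(1) in_arcsD2 by (auto simp: fixpoints_def)
  show ?case
  proof (cases "w \<in> side T a b")
    case True
    then have "{y, w} = {a, b}" using arc_preserves_side[OF w(1)] less.prems(2) by blast
    with wfix less.prems(1) show ?thesis by (auto simp: doubleton_eq_iff)
  next
    case False
    with less.hyps[OF w(3) wfix] show ?thesis by simp
  qed
qed

lemma fixpoints_act:
  assumes "g \<in> carrier G" "h \<in> carrier G" "g \<otimes> h = h \<otimes> g" "x \<in> fixpoints g"
  shows "\<phi> h x \<in> fixpoints g"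
proof -
  have "\<phi> g (\<phi> h x) = \<phi> h (\<phi> g x)"
    using assms composition_rule[of x g h] composition_rule[of x h g] by (auto simp: fixpoints_def)
  then show ?thesis using assms element_image[OF assms(2)] by (auto simp: fixpoints_def)
qed

text \<open>Take a fixed point \<open>q\<close> of \<open>h\<close> closest to the fixed points of \<open>g\<close>. If \<open>h\<close> moves the first edge towards
  \<open>p \<in> Fix g\<close>, then \<open>p\<close> and \<open>h p\<close>, both fixed by \<open>g\<close>, are seen from \<open>q\<close> in different directions, so
  \<open>g\<close> fixes \<open>q\<close> by convexity.\<close>

lemma commuting_elliptics_meet:
  assumes g: "g \<in> carrier G" "fixpoints g \<noteq> {}" and h: "h \<in> carrier G" "fixpoints h \<noteq> {}"
    and comm: "g \<otimes> h = h \<otimes> g"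
  shows "fixpoints g \<inter> fixpoints h \<noteq> {}"
proof -
  obtain q where q: "q \<in> fixpoints h"
    and min: "\<And>q'. q' \<in> fixpoints h \<Longrightarrow> setdist T q (fixpoints g) \<le> setdist T q' (fixpoints g)"
    using ex_has_least_nat[of "\<lambda>q. q \<in> fixpoints h" _ "\<lambda>q. setdist T q (fixpoints g)"] h(2) by blast
  have "q \<in> fixpoints g"
  proof (rule ccontr)
    assume "q \<notin> fixpoints g"
    moreover have "q \<in> pverts T" "\<phi> h q = q" "fixpoints g \<subseteq> pverts T"
      using q by (auto simp: fixpoints_def)
    ultimately obtain w p where w: "(q, w) \<in> parcs T" "p \<in> fixpoints g" "p \<in> side T q w"
      "setdist T w (fixpoints g) < setdist T q (fixpoints g)"
      using g(2) by (blast elim: step_towards[of q "fixpoints g"])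
    with min have "w \<notin> fixpoints h" using leD by blast
    then have "\<phi> h w \<noteq> w" using in_arcsD2[OF w(1)] by (simp add: fixpoints_def)
    moreover have "(q, \<phi> h w) \<in> parcs T" using act_arc[OF h(1) w(1)] \<open>\<phi> h q = q\<close> by simp
    ultimately have "side T q w \<inter> side T q (\<phi> h w) = {}" using sides_disjoint[OF w(1)] by metis
    moreover have "\<phi> h p \<in> side T q (\<phi> h w)" using act_side[OF h(1) w(1,3)] \<open>\<phi> h q = q\<close> by simp
    ultimately have "\<phi> h p \<notin> side T q w" by blast
    with fixpoints_convex[OF g(1) w(1) fixpoints_act[OF g(1) h(1) comm w(2)] _ w(2,3)]
      \<open>q \<notin> fixpoints g\<close> show False by blast
  qed
  with q show ?thesis by blast
qed

text \<open>The elements of \<open>F\<close> that move a given edge have their fixed point sets on one side of it, and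
  commuting ones have them on the same side. So if the commutation graph on them is connected, the
  edge points to a side. Following these directions decreases the total distance to the fixed point
  sets, so a vertex where this distance is minimal is fixed by all of \<open>F\<close>.\<close>

lemma elliptic_if_movers_connected:
  assumes F: "finite F" "F \<subseteq> carrier G" and ell: "\<And>f. f \<in> F \<Longrightarrow> fixpoints f \<noteq> {}"
    and conn: "\<And>a b f f'. (a, b) \<in> parcs T \<Longrightarrow>
      f \<in> F \<Longrightarrow> \<not> {a, b} \<subseteq> fixpoints f \<Longrightarrow> f' \<in> F \<Longrightarrow> \<not> {a, b} \<subseteq> fixpoints f' \<Longrightarrow>
      (f, f') \<in> {(f, f'). f' \<in> F \<and> \<not> {a, b} \<subseteq> fixpoints f' \<and> f \<otimes> f' = f' \<otimes> f}\<^sup>*"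
  shows "elliptic T \<phi> (generate G F)"
proof -
  let ?D = "\<lambda>x. \<Sum>f\<in>F. setdist T x (fixpoints f)"
  have sub: "fixpoints f \<subseteq> pverts T" for f by (auto simp: fixpoints_def)
  obtain x where x: "x \<in> pverts T" and min: "\<And>y. y \<in> pverts T \<Longrightarrow> ?D x \<le> ?D y"
    using ex_has_least_nat[of "\<lambda>x. x \<in> pverts T" _ ?D] tree_nonempty by blast
  have fix_x: "x \<in> fixpoints f" if f: "f \<in> F" for f
  proof (rule ccontr)
    assume "x \<notin> fixpoints f"
    with x sub ell[OF f] obtain y d where y: "(x, y) \<in> parcs T" "d \<in> fixpoints f" "d \<in> side T x y"
      by (blast elim: step_towards[of x "fixpoints f"])
    have side: "fixpoints f' \<subseteq> side T x y" if f': "f' \<in> F" "\<not> {x, y} \<subseteq> fixpoints f'" for f'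
    proof -
      have one_side: "fixpoints k \<subseteq> side T x y"
        if "k \<in> F" "\<not> {x, y} \<subseteq> fixpoints k" "fixpoints k \<inter> side T x y \<noteq> {}" for k
        using fixpoints_convex[of k x y] that F(2) y(1) by blast
      have "\<not> {x, y} \<subseteq> fixpoints f" using \<open>x \<notin> fixpoints f\<close> by blast
      from conn[OF y(1) f this f'] have "f' \<in> F \<and> fixpoints f' \<subseteq> side T x y"
      proof induction
        case base
        show ?case using one_side[OF f] \<open>\<not> {x, y} \<subseteq> fixpoints f\<close> y f by blast
      next
        case (step k k')
        then have "fixpoints k \<inter> fixpoints k' \<noteq> {}"
          using F(2) ell by (intro commuting_elliptics_meet) auto
        with step one_side[of k'] show ?case by blast
      qed
      then show ?thesis by simp
    qed
    have "?D y < ?D x"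
    proof (rule sum_strict_mono_ex1[OF F(1)])
      show "\<forall>k\<in>F. setdist T y (fixpoints k) \<le> setdist T x (fixpoints k)"
      proof
        fix k assume k: "k \<in> F"
        show "setdist T y (fixpoints k) \<le> setdist T x (fixpoints k)"
        proof (cases "{x, y} \<subseteq> fixpoints k")
          case True
          then show ?thesis by (simp add: setdist_zero)
        next
          case False
          then show ?thesis
            using setdist_decreases[OF y(1) sub ell[OF k] side[OF k]] by simp
        qed
      qed
      have "\<not> {x, y} \<subseteq> fixpoints f" using \<open>x \<notin> fixpoints f\<close> by blast
      from setdist_decreases[OF y(1) sub ell[OF f] side[OF f this]]
      show "\<exists>k\<in>F. setdist T y (fixpoints k) < setdist T x (fixpoints k)" using f by blast
    qed
    moreover have "?D x \<le> ?D y" using min in_arcsD2[OF y(1)] by blast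
    ultimately show False by simp
  qed
  have "F \<subseteq> stabilizer G \<phi> x"
    using fix_x F(2) by (auto simp: stabilizer_def fixpoints_def)
  from generate_subgroup_incl[OF this stabilizer_subgroup[OF x]]
  show ?thesis using x by (auto simp: elliptic_def stabilizer_def)
qed

text \<open>If \<open>H\<close> fixes \<open>x\<close>, then its conjugate fixes \<open>g x\<close>.\<close>

lemma elliptic_conjugate:
  assumes "elliptic T \<phi> H" "H \<subseteq> carrier G" "g \<in> carrier G"
  shows "elliptic T \<phi> {h \<in> carrier G. inv g \<otimes> h \<otimes> g \<in> H}"
proof -
  obtain x where x: "x \<in> pverts T" "\<And>h. h \<in> H \<Longrightarrow> \<phi> h x = x"
    using assms(1) by (auto simp: elliptic_def)
  have "\<phi> h (\<phi> g x) = \<phi> g x" if h: "h \<in> carrier G" "inv g \<otimes> h \<otimes> g \<in> H" for h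
  proof -
    have "h \<otimes> g = g \<otimes> (inv g \<otimes> h \<otimes> g)" using h(1) assms(3) by (simp flip: m_assoc)
    then have "\<phi> h (\<phi> g x) = \<phi> g (\<phi> (inv g \<otimes> h \<otimes> g) x)"
      using composition_rule[OF x(1) h(1) assms(3)] composition_rule[OF x(1) assms(3)] h assms(3)
      by simp
    with x(2)[OF h(2)] show ?thesis by simp
  qed
  moreover have "\<phi> g x \<in> pverts T" using element_image[OF assms(3) x(1)] by simp
  ultimately show ?thesis by (auto simp: elliptic_def)
qed

end

section \<open>Counting edges of trees\<close>

text \<open>The edges are a parameter so that one of them can be removed, or only those kept whose group contains
  a given generator.\<close>

definition ends :: "('i, 'j) pre_digraph \<Rightarrow> 'j set \<Rightarrow> ('i \<times> 'i) set" where
  "ends U E = (\<Union>e\<in>E. {(tail U e, head U e), (head U e, tail U e)})"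

lemma ends_mono: "E \<subseteq> E' \<Longrightarrow> ends U E \<subseteq> ends U E'"
  by (auto simp: ends_def)

lemma sym_ends_rtrancl: "(x, y) \<in> (ends U E)\<^sup>* \<Longrightarrow> (y, x) \<in> (ends U E)\<^sup>*"
  by (rule symD[OF sym_rtrancl]) (auto simp: ends_def sym_def)

text \<open>Each vertex other than the root is charged to an edge from it to a vertex closer to the root.\<close>

lemma card_verts_le_if_connected:
  assumes "finite E" and r: "r \<in> V" and conn: "\<And>v. v \<in> V \<Longrightarrow> (r, v) \<in> (ends U E)\<^sup>*"
  shows "card V \<le> Suc (card E)"
proof -
  define d where "d v = (LEAST n. (r, v) \<in> ends U E ^^ n)" for v
  have closer: "\<exists>e\<in>E. \<exists>w. {tail U e, head U e} = {v, w} \<and> d w < d v" if "v \<in> V - {r}" for v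
  proof -
    from that conn have "\<exists>n. (r, v) \<in> ends U E ^^ n" by (auto simp: rtrancl_power)
    then have v: "(r, v) \<in> ends U E ^^ d v" unfolding d_def by (rule LeastI_ex)
    have "d v \<noteq> 0"
    proof
      assume "d v = 0"
      with v have "r = v" by (metis relpow_0_E)
      with that show False by simp
    qed
    then obtain n where n: "d v = Suc n" using not0_implies_Suc by blast
    with v obtain w where w: "(r, w) \<in> ends U E ^^ n" "(w, v) \<in> ends U E" by auto
    have "d w \<le> n" unfolding d_def using w(1) by (rule Least_le)
    with n w(2) show ?thesis by (fastforce simp: ends_def)
  qed
  define f where "f v = (SOME e. e \<in> E \<and> (\<exists>w. {tail U e, head U e} = {v, w} \<and> d w < d v))" for v
  have f: "f v \<in> E \<and> (\<exists>w. {tail U (f v), head U (f v)} = {v, w} \<and> d w < d v)" if "v \<in> V - {r}" for v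
    unfolding f_def by (rule someI_ex) (use closer[OF that] in blast)
  have "inj_on f (V - {r})"
  proof (rule inj_onI)
    fix v v' assume vv: "v \<in> V - {r}" "v' \<in> V - {r}" "f v = f v'"
    obtain w w' where "{tail U (f v), head U (f v)} = {v, w}" "d w < d v"
      "{tail U (f v'), head U (f v')} = {v', w'}" "d w' < d v'"
      using f[OF vv(1)] f[OF vv(2)] by blast
    with vv(3) show "v = v'" by (auto simp: doubleton_eq_iff)
  qed
  moreover have "f ` (V - {r}) \<subseteq> E" using f by blast
  ultimately have "card (V - {r}) \<le> card E" using \<open>finite E\<close> by (rule card_inj_on_le)
  then show ?thesis by (simp add: card_Diff_singleton[OF r])
qed

text \<open>If the graph stayed connected without some edge, then it would have at least \<open>card (verts U)\<close> edges.
  So every edge is a bridge, which excludes loops, parallel edges and cycles at once.\<close>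

lemma underlying_tree_if_card:
  assumes "wf_digraph U" "finite (verts U)" "finite (arcs U)"
    and card: "card (verts U) = Suc (card (arcs U))"
    and conn: "\<And>x y. x \<in> verts U \<Longrightarrow> y \<in> verts U \<Longrightarrow> (x, y) \<in> (ends U (arcs U))\<^sup>*"
  shows "underlying_tree U"
proof -
  interpret wf_digraph U by fact
  have parcs: "parcs (mk_symmetric U) = ends U (arcs U)"
    by (simp add: parcs_mk_symmetric ends_def)
  have ne: "verts U \<noteq> {}" using card by auto
  have bridge: "(tail U e, head U e) \<notin> (ends U (arcs U - {e}))\<^sup>*" if e: "e \<in> arcs U" for e
  proof
    assume *: "(tail U e, head U e) \<in> (ends U (arcs U - {e}))\<^sup>*"
    have "ends U (arcs U) \<subseteq> (ends U (arcs U - {e}))\<^sup>*"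
    proof (clarify)
      fix x y assume "(x, y) \<in> ends U (arcs U)"
      then obtain e' where e': "e' \<in> arcs U"
        "(x, y) = (tail U e', head U e') \<or> (x, y) = (head U e', tail U e')"
        by (auto simp: ends_def)
      show "(x, y) \<in> (ends U (arcs U - {e}))\<^sup>*"
      proof (cases "e' = e")
        case True
        then show ?thesis using e' * sym_ends_rtrancl[OF *] by auto
      next
        case False
        then have "(x, y) \<in> ends U (arcs U - {e})" using e' by (auto simp: ends_def)
        then show ?thesis by (rule r_into_rtrancl)
      qed
    qed
    then have "(ends U (arcs U))\<^sup>* \<subseteq> (ends U (arcs U - {e}))\<^sup>*"
      by (rule rtrancl_subset_rtrancl)
    with conn have "(tail U e, v) \<in> (ends U (arcs U - {e}))\<^sup>*" if "v \<in> verts U" for v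
      using that tail_in_verts[OF e] by blast
    then have "card (verts U) \<le> Suc (card (arcs U - {e}))"
      using \<open>finite (arcs U)\<close> tail_in_verts[OF e] by (intro card_verts_le_if_connected) auto
    with card card_Diff_singleton[OF e] e \<open>finite (arcs U)\<close> show False
      by (metis Suc_le_mono card_Diff1_less leD)
  qed
  have no_loop: "tail U e \<noteq> head U e" if "e \<in> arcs U" for e
    using bridge[OF that] by auto
  have inj: "inj_on (\<lambda>e. {tail U e, head U e}) (arcs U)"
  proof (rule inj_onI, rule ccontr)
    fix e e' assume e: "e \<in> arcs U" "e' \<in> arcs U" "{tail U e, head U e} = {tail U e', head U e'}" "e \<noteq> e'"
    then have "(tail U e, head U e) \<in> ends U (arcs U - {e})"
      by (auto simp: ends_def doubleton_eq_iff)
    with bridge[OF e(1)] show False by blast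
  qed
  have sym: "symmetric (mk_symmetric U)" by (rule symmetric_mk_symmetric)
  interpret S: pair_bidirected_digraph "mk_symmetric U"
    by unfold_locales (use sym no_loop no_loop[symmetric] in \<open>auto simp: parcs ends_def\<close>)
  have "\<exists>H. a \<in> H \<and> b \<notin> H \<and> (\<forall>x y. (x, y) \<in> parcs (mk_symmetric U) \<longrightarrow> {x, y} \<noteq> {a, b} \<longrightarrow>
      (x \<in> H \<longleftrightarrow> y \<in> H))" if "(a, b) \<in> parcs (mk_symmetric U)" for a b
  proof -
    obtain e where e: "e \<in> arcs U"
      "(a, b) = (tail U e, head U e) \<or> (a, b) = (head U e, tail U e)"
      using \<open>(a, b) \<in> parcs (mk_symmetric U)\<close> by (auto simp: parcs ends_def)
    let ?H = "{z. (a, z) \<in> (ends U (arcs U - {e}))\<^sup>*}"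
    have "b \<notin> ?H" using e(2) bridge[OF e(1)] sym_ends_rtrancl[of a b] by auto
    moreover have "x \<in> ?H \<longleftrightarrow> y \<in> ?H" if xy: "(x, y) \<in> parcs (mk_symmetric U)" "{x, y} \<noteq> {a, b}" for x y
    proof -
      obtain e' where e': "e' \<in> arcs U"
        "(x, y) = (tail U e', head U e') \<or> (x, y) = (head U e', tail U e')"
        using xy(1) by (auto simp: parcs ends_def)
      with xy(2) e(2) have "e' \<noteq> e" by auto
      with e' have "(x, y) \<in> ends U (arcs U - {e})" "(y, x) \<in> ends U (arcs U - {e})"
        by (auto simp: ends_def)
      then show ?thesis by (auto intro: rtrancl_into_rtrancl)
    qed
    ultimately show ?thesis by (intro exI[of _ ?H]) blast
  qed
  moreover have "Digraph_Component.connected (with_proj (mk_symmetric U))"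
    using conn ne by (simp add: connected_with_proj_iff[OF S.pair_sym_digraph_axioms] parcs)
  ultimately have "simplicial_tree (mk_symmetric U)"
    unfolding simplicial_tree_iff_halfspaces using S.pair_bidirected_digraph_axioms by blast
  with inj \<open>wf_digraph U\<close> show ?thesis by (simp add: underlying_tree_def)
qed

section \<open>Bass--Serre trees of trees of groups\<close>

lemma (in group) lcoset_eq_iff:
  assumes "subgroup H G" "g \<in> carrier G" "g' \<in> carrier G"
  shows "g <# H = g' <# H \<longleftrightarrow> inv g \<otimes> g' \<in> H"
proof
  assume "g <# H = g' <# H"
  moreover have "g' \<in> g' <# H"
    using assms subgroup.one_closed[OF assms(1)] by (auto simp: l_coset_def intro!: bexI[of _ \<one>])
  ultimately obtain h where "h \<in> H" "g' = g \<otimes> h" by (auto simp: l_coset_def)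
  then show "inv g \<otimes> g' \<in> H"
    using assms subgroup.mem_carrier[OF assms(1)] by (simp flip: m_assoc)
next
  assume "inv g \<otimes> g' \<in> H"
  then have "g' \<in> g <# H" using assms by (intro subgroup.lcos_module_rev) auto
  then show "g <# H = g' <# H" using assms by (intro l_repr_independence)
qed

text \<open>The semidirect product of the integer functions on \<open>G\<close> with \<open>G\<close>. A homomorphism \<open>g \<mapsto> (b g, g)\<close> from
  \<open>G\<close> to it is the same as a 1-cocycle \<open>b\<close>.\<close>

definition cocycle_group :: "('g, 'm) monoid_scheme \<Rightarrow> (('g \<Rightarrow> int) \<times> 'g) monoid" where
  "cocycle_group G =
    \<lparr>carrier = {(f, g). g \<in> carrier G \<and> (\<forall>k. k \<notin> carrier G \<longrightarrow> f k = 0)},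
     monoid.mult = (\<lambda>(f, g) (f', g').
       (\<lambda>k. if k \<in> carrier G then f k + f' (inv\<^bsub>G\<^esub> g \<otimes>\<^bsub>G\<^esub> k) else 0, g \<otimes>\<^bsub>G\<^esub> g')),
     one = (\<lambda>_. 0, \<one>\<^bsub>G\<^esub>)\<rparr>"

lemma (in group) group_cocycle_group: "group (cocycle_group G)"
proof (rule groupI)
  fix x assume x: "x \<in> carrier (cocycle_group G)"
  obtain f g where fg: "x = (f, g)" by (cases x)
  show "\<exists>y\<in>carrier (cocycle_group G). y \<otimes>\<^bsub>cocycle_group G\<^esub> x = \<one>\<^bsub>cocycle_group G\<^esub>"
    using x fg
    by (intro bexI[of _ "(\<lambda>k. if k \<in> carrier G then - f (g \<otimes> k) else 0, inv g)"])
      (auto simp: cocycle_group_def fun_eq_iff)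
qed (auto simp: cocycle_group_def fun_eq_iff inv_mult_group m_assoc)

locale tree_of_groups = group G for G :: "('g, 'm) monoid_scheme" (structure) +
  fixes \<G> :: "('i, 'j, 'g set) labelled_graph"
  assumes is_decomposition: "decomposition G \<G>"
begin

abbreviation "U \<equiv> ugraph \<G>"

lemma U_tree: "underlying_tree U"
  using is_decomposition by (simp add: decomposition_def)

sublocale wf_digraph U
  using U_tree by (simp add: underlying_tree_def)

sublocale U: tree_graph "mk_symmetric U"
  using U_tree by (simp add: underlying_tree_def tree_graph_def)

lemma parcs_U: "parcs (mk_symmetric U) = ends U (arcs U)"
  by (simp add: parcs_mk_symmetric ends_def)

lemma U_arc: "e \<in> arcs U \<Longrightarrow> (tail U e, head U e) \<in> parcs (mk_symmetric U)"
  by (auto simp: parcs_U ends_def)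

lemma U_no_loop: "e \<in> arcs U \<Longrightarrow> tail U e \<noteq> head U e"
  using U.no_loops' U_arc by blast

lemma U_no_parallel:
  "e \<in> arcs U \<Longrightarrow> e' \<in> arcs U \<Longrightarrow> {tail U e, head U e} = {tail U e', head U e'} \<Longrightarrow> e = e'"
  using U_tree by (simp add: underlying_tree_def inj_on_def)

lemma vertex_subgroup: "x \<in> verts U \<Longrightarrow> subgroup (vlabel \<G> x) G"
  and edge_subgroup: "e \<in> arcs U \<Longrightarrow> subgroup (elabel \<G> e) G"
  and edge_subset_tail: "e \<in> arcs U \<Longrightarrow> elabel \<G> e \<subseteq> vlabel \<G> (tail U e)"
  and edge_subset_head: "e \<in> arcs U \<Longrightarrow> elabel \<G> e \<subseteq> vlabel \<G> (head U e)"
  using is_decomposition by (auto simp: decomposition_def)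

lemma vertex_carrier: "x \<in> verts U \<Longrightarrow> vlabel \<G> x \<subseteq> carrier G"
  using vertex_subgroup subgroup.subset by blast

lemma vertex_mem_carrier: "x \<in> verts U \<Longrightarrow> g \<in> vlabel \<G> x \<Longrightarrow> g \<in> carrier G"
  using vertex_carrier by blast

abbreviation "P \<equiv> presented_group (fg_gens \<G>) (fg_relators G \<G>)"
abbreviation "gen x g \<equiv> presented_gen (fg_gens \<G>) (fg_relators G \<G>) (x, g)"

text \<open>Homomorphisms on the vertex groups that agree on the edge groups kill the relators of the
  fundamental group, so they factor through it, and it is identified with \<open>G\<close>.\<close>

lemma hom_from_vertex_groups:
  assumes "group H"
    and hom: "\<And>x. x \<in> verts U \<Longrightarrow> f x \<in> hom (G\<lparr>carrier := vlabel \<G> x\<rparr>) H"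
    and edge: "\<And>e g. e \<in> arcs U \<Longrightarrow> g \<in> elabel \<G> e \<Longrightarrow> f (tail U e) g = f (head U e) g"
  obtains h where "h \<in> hom G H" "\<And>x g. x \<in> verts U \<Longrightarrow> g \<in> vlabel \<G> x \<Longrightarrow> h g = f x g"
proof -
  interpret H: group H by fact
  obtain \<psi> where \<psi>: "\<psi> \<in> iso P G" "\<And>x g. (x, g) \<in> fg_gens \<G> \<Longrightarrow> \<psi> (gen x g) = g"
    using is_decomposition by (fastforce simp: decomposition_def)
  have f_closed: "f x g \<in> carrier H" if "x \<in> verts U" "g \<in> vlabel \<G> x" for x g
    using hom_in_carrier[OF hom[OF that(1)]] that(2) by simp
  have f_mult: "f x (g \<otimes> g') = f x g \<otimes>\<^bsub>H\<^esub> f x g'"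
    if "x \<in> verts U" "g \<in> vlabel \<G> x" "g' \<in> vlabel \<G> x" for x g g'
    using hom_mult[OF hom[OF that(1)]] that(2,3) by simp
  have R: "word_val H (\<lambda>(x, g). f x g) r = \<one>\<^bsub>H\<^esub>" if "r \<in> fg_relators G \<G>" for r
  proof -
    consider x g g' where "r = [((x, g), True), ((x, g'), True), ((x, g \<otimes> g'), False)]"
        "x \<in> verts U" "g \<in> vlabel \<G> x" "g' \<in> vlabel \<G> x"
      | e g where "r = [((tail U e, g), True), ((head U e, g), False)]" "e \<in> arcs U" "g \<in> elabel \<G> e"
      using \<open>r \<in> fg_relators G \<G>\<close> by (auto simp: fg_relators_def)
    then show ?thesis
    proof cases
      case 1
      then show ?thesis using f_closed f_mult by (simp flip: H.m_assoc)
    next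
      case 2
      then have "g \<in> vlabel \<G> (head U e)" using edge_subset_head by blast
      with 2 show ?thesis using f_closed[of "head U e" g] edge by simp
    qed
  qed
  have "(\<lambda>(x, g). f x g) \<in> fg_gens \<G> \<rightarrow> carrier H"
    using f_closed by (auto simp: fg_gens_def)
  then obtain h where h: "h \<in> hom P H"
    "\<And>s. s \<in> fg_gens \<G> \<Longrightarrow>
      h (presented_gen (fg_gens \<G>) (fg_relators G \<G>) s) = (\<lambda>(x, g). f x g) s"
    using H.presented_group_hom_exists[of _ _ "fg_relators G \<G>", OF _ R] by blast
  define \<psi>' where "\<psi>' = inv_into (carrier P) \<psi>"
  have "\<psi>' \<in> hom G P"
    using group.iso_set_sym[OF group_presented_group \<psi>(1)] by (simp add: \<psi>'_def iso_def)
  then have "h \<circ> \<psi>' \<in> hom G H" using h(1) by (rule Group.hom_compose)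
  moreover have "(h \<circ> \<psi>') g = f x g" if "x \<in> verts U" "g \<in> vlabel \<G> x" for x g
  proof -
    have xg: "(x, g) \<in> fg_gens \<G>" using that by (simp add: fg_gens_def)
    have "inj_on \<psi> (carrier P)" using \<psi>(1) by (simp add: iso_def bij_betw_def)
    then have "\<psi>' g = gen x g"
      using inv_into_f_f[OF _ presented_gen_closed[OF xg]] \<psi>(2)[OF xg] by (metis \<psi>'_def)
    with h(2)[OF xg] show ?thesis by simp
  qed
  ultimately show thesis by (rule that)
qed

text \<open>The generators of the fundamental group are by definition the elements of the vertex groups.\<close>

lemma generated_by_vertex_groups: "generate G (\<Union>x\<in>verts U. vlabel \<G> x) = carrier G"
proof
  let ?V = "\<Union>x\<in>verts U. vlabel \<G> x"
  have V: "?V \<subseteq> carrier G" using vertex_carrier by blast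
  then show "generate G ?V \<subseteq> carrier G" by (rule generate_incl)
  obtain \<psi> where \<psi>: "\<psi> \<in> iso P G" "\<And>x g. (x, g) \<in> fg_gens \<G> \<Longrightarrow> \<psi> (gen x g) = g"
    using is_decomposition by (fastforce simp: decomposition_def)
  interpret \<psi>: group_hom P G \<psi>
    using \<psi>(1) group_presented_group is_group
    by (simp add: group_hom_def group_hom_axioms_def iso_def)
  have "presented_gen (fg_gens \<G>) (fg_relators G \<G>) ` fg_gens \<G> \<subseteq> carrier P"
    by (intro image_subsetI presented_gen_closed)
  from \<psi>.generate_img[OF this]
  have "\<psi> ` carrier P = generate G (\<psi> ` (presented_gen (fg_gens \<G>) (fg_relators G \<G>) ` fg_gens \<G>))"
    by (simp add: presented_group_generated)
  also have "\<dots> \<subseteq> generate G ?V"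
    by (rule mono_generate) (auto simp: \<psi>(2), auto simp: fg_gens_def)
  finally show "carrier G \<subseteq> generate G ?V" using \<psi>(1) by (simp add: iso_def bij_betw_def)
qed

definition halfspace_at :: "'j \<Rightarrow> 'i set \<Rightarrow> bool" where
  "halfspace_at e A \<longleftrightarrow> tail U e \<in> A \<and> head U e \<notin> A \<and>
    (\<forall>e'\<in>arcs U. e' \<noteq> e \<longrightarrow> (tail U e' \<in> A \<longleftrightarrow> head U e' \<in> A))"

definition wall_cocycle :: "'j \<Rightarrow> 'i set \<Rightarrow> ('g \<Rightarrow> 'g \<Rightarrow> int) \<Rightarrow> bool" where
  "wall_cocycle e A b \<longleftrightarrow>
    (\<forall>g\<in>carrier G. \<forall>h\<in>carrier G. \<forall>k\<in>carrier G. b (g \<otimes> h) k = b g k + b h (inv g \<otimes> k)) \<and>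
    (\<forall>x\<in>verts U. \<forall>h\<in>vlabel \<G> x. \<forall>k\<in>carrier G. b h k =
      (if x \<in> A then 0 else of_bool (k \<in> elabel \<G> e) - of_bool (inv h \<otimes> k \<in> elabel \<G> e)))"

lemma wall_cocycle_mult:
  assumes "wall_cocycle e A b" "g \<in> carrier G" "h \<in> carrier G" "k \<in> carrier G"
  shows "b (g \<otimes> h) k = b g k + b h (inv g \<otimes> k)"
  using assms by (simp add: wall_cocycle_def)

lemma wall_cocycle_vertex:
  assumes "wall_cocycle e A b" "x \<in> verts U" "h \<in> vlabel \<G> x" "k \<in> carrier G"
  shows "b h k =
    (if x \<in> A then 0 else of_bool (k \<in> elabel \<G> e) - of_bool (inv h \<otimes> k \<in> elabel \<G> e))"
  using assms by (simp add: wall_cocycle_def)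

text \<open>An edge \<open>e\<close> with a halfspace \<open>A\<close> of the underlying tree determines a cocycle that counts, with
  signs, the edges \<open>k G\<^sub>e\<close> of the Bass--Serre tree separating the base vertices from their translates.
  On the vertex groups in \<open>A\<close> it vanishes; on the others it is the coboundary of the indicator
  function of \<open>G\<^sub>e\<close>. Both agree on \<open>G\<^sub>e\<close>, so the universal property provides it.\<close>

lemma wall_cocycle_exists:
  assumes e: "e \<in> arcs U" and A: "halfspace_at e A"
  shows "\<exists>b. wall_cocycle e A b"
proof -
  let ?H = "cocycle_group G"
  define f where "f x g = (\<lambda>k. if k \<in> carrier G \<and> x \<notin> A
      then of_bool (k \<in> elabel \<G> e) - of_bool (inv g \<otimes> k \<in> elabel \<G> e) else (0::int), g)" for x g
  have "f x \<in> hom (G\<lparr>carrier := vlabel \<G> x\<rparr>) ?H" if "x \<in> verts U" for x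
    using vertex_mem_carrier[OF that]
    by (intro homI) (auto simp: f_def cocycle_group_def fun_eq_iff inv_mult_group m_assoc)
  moreover have "f (tail U e') g = f (head U e') g" if e': "e' \<in> arcs U" "g \<in> elabel \<G> e'" for e' g
  proof (cases "e' = e")
    case True
    then interpret E: subgroup "elabel \<G> e" G using edge_subgroup e by simp
    have g: "g \<in> elabel \<G> e" "g \<in> carrier G" using e' True E.mem_carrier by auto
    have "inv g \<otimes> k \<in> elabel \<G> e \<longleftrightarrow> k \<in> elabel \<G> e" if "k \<in> carrier G" for k
    proof
      assume "inv g \<otimes> k \<in> elabel \<G> e"
      from E.m_closed[OF g(1) this] g that show "k \<in> elabel \<G> e" by (simp flip: m_assoc)
    qed (use g in \<open>auto\<close>)
    with True A show ?thesis by (auto simp: f_def fun_eq_iff halfspace_at_def)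
  next
    case False
    with A e'(1) show ?thesis by (simp add: f_def halfspace_at_def)
  qed
  ultimately obtain \<theta> where \<theta>: "\<theta> \<in> hom G ?H"
    "\<And>x g. x \<in> verts U \<Longrightarrow> g \<in> vlabel \<G> x \<Longrightarrow> \<theta> g = f x g"
    using hom_from_vertex_groups[OF group_cocycle_group, of f] by metis
  have snd_hom: "snd \<in> hom ?H G" by (auto simp: hom_def cocycle_group_def)
  have snd: "snd (\<theta> g) = g" if "g \<in> carrier G" for g
  proof -
    have "(snd \<circ> \<theta>) g = id g"
    proof (rule hom_eq_on_generate[of G G "snd \<circ> \<theta>" id "\<Union>x\<in>verts U. vlabel \<G> x"])
      show "snd \<circ> \<theta> \<in> hom G G" using \<theta>(1) snd_hom by (rule Group.hom_compose)
      show "id \<in> hom G G" by (auto simp: hom_def)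
      show "(snd \<circ> \<theta>) s = id s" if "s \<in> (\<Union>x\<in>verts U. vlabel \<G> x)" for s
        using that \<theta>(2) by (auto simp: f_def)
    qed (use that generated_by_vertex_groups vertex_carrier is_group in auto)
    then show ?thesis by simp
  qed
  show ?thesis
    unfolding wall_cocycle_def
  proof (intro exI[of _ "\<lambda>g. fst (\<theta> g)"] conjI ballI)
    fix g h k assume gh: "g \<in> carrier G" "h \<in> carrier G" and k: "k \<in> carrier G"
    obtain f1 f2 where "\<theta> g = (f1, g)" "\<theta> h = (f2, h)"
      using snd[OF gh(1)] snd[OF gh(2)] by (metis prod.collapse)
    then show "fst (\<theta> (g \<otimes> h)) k = fst (\<theta> g) k + fst (\<theta> h) (inv g \<otimes> k)"
      using hom_mult[OF \<theta>(1) gh] k by (simp add: cocycle_group_def)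
  next
    fix x h k assume "x \<in> verts U" "h \<in> vlabel \<G> x" "k \<in> carrier G"
    then show "fst (\<theta> h) k =
        (if x \<in> A then 0 else of_bool (k \<in> elabel \<G> e) - of_bool (inv h \<otimes> k \<in> elabel \<G> e))"
      using \<theta>(2) by (simp add: f_def)
  qed
qed

lemma halfspace_at_exists:
  assumes e: "e \<in> arcs U"
  shows "\<exists>A. halfspace_at e A"
proof -
  let ?A = "side (mk_symmetric U) (head U e) (tail U e)"
  have he: "(head U e, tail U e) \<in> parcs (mk_symmetric U)" using U_arc[OF e] by (rule U.arcs_symmetric)
  have "tail U e' \<in> ?A \<longleftrightarrow> head U e' \<in> ?A" if e': "e' \<in> arcs U" "e' \<noteq> e" for e'
  proof -
    have "{tail U e', head U e'} \<noteq> {head U e, tail U e}"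
      using U_no_parallel[OF e e'(1)] e'(2) by (auto simp: insert_commute)
    with U_arc[OF e'(1)] show ?thesis by (rule U.arc_preserves_side)
  qed
  then have "halfspace_at e ?A"
    using U.near_end_in_side U.far_end_not_in_side[OF he] by (simp add: halfspace_at_def)
  then show ?thesis ..
qed

text \<open>For \<open>h\<close> in both vertex groups, the two formulas for the cocycle at \<open>h\<close> agree at \<open>\<one>\<close>. They read
  \<open>0\<close> and \<open>1 - [h\<^sup>-\<^sup>1 \<in> G\<^sub>e]\<close>.\<close>

lemma vertex_groups_meet_in_edge_group:
  assumes e: "e \<in> arcs U"
  shows "vlabel \<G> (tail U e) \<inter> vlabel \<G> (head U e) = elabel \<G> e"
proof
  show "vlabel \<G> (tail U e) \<inter> vlabel \<G> (head U e) \<subseteq> elabel \<G> e"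
  proof
    fix h assume h: "h \<in> vlabel \<G> (tail U e) \<inter> vlabel \<G> (head U e)"
    interpret E: subgroup "elabel \<G> e" G using e by (rule edge_subgroup)
    obtain A b where A: "halfspace_at e A" and b: "wall_cocycle e A b"
      using halfspace_at_exists[OF e] wall_cocycle_exists[OF e] by blast
    have hc: "h \<in> carrier G" using h vertex_mem_carrier[OF tail_in_verts[OF e]] by blast
    have "b h \<one> = 0" using wall_cocycle_vertex[OF b, of "tail U e" h \<one>] h A e
      by (simp add: halfspace_at_def)
    moreover have "b h \<one> = 1 - of_bool (inv h \<in> elabel \<G> e)"
      using wall_cocycle_vertex[OF b, of "head U e" h \<one>] h A e hc by (simp add: halfspace_at_def)
    ultimately have "inv h \<in> elabel \<G> e" by (simp split: if_splits)
    then have "inv (inv h) \<in> elabel \<G> e" by (rule E.m_inv_closed)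
    with hc show "h \<in> elabel \<G> e" by simp
  qed
qed (use edge_subset_tail[OF e] edge_subset_head[OF e] in blast)

end

context tree_of_groups
begin

abbreviation "B \<equiv> bass_serre_tree G \<G>"
abbreviation "act \<equiv> bass_serre_action G \<G>"
abbreviation "vtx x g \<equiv> (x, g <# vlabel \<G> x)"

lemma pverts_B: "pverts B = {vtx x g | x g. x \<in> verts U \<and> g \<in> carrier G}"
  by (simp add: bass_serre_tree_def Let_def)

lemma vtx_in_pverts: "x \<in> verts U \<Longrightarrow> g \<in> carrier G \<Longrightarrow> vtx x g \<in> pverts B"
  by (auto simp: pverts_B)

lemma parcs_B_iff:
  "(p, q) \<in> parcs B \<longleftrightarrow> (\<exists>e\<in>arcs U. \<exists>g\<in>carrier G.
    p = vtx (tail U e) g \<and> q = vtx (head U e) g \<or> p = vtx (head U e) g \<and> q = vtx (tail U e) g)"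
  by (auto simp: bass_serre_tree_def Let_def)

lemma vtx_eq_iff:
  assumes "x \<in> verts U" "g \<in> carrier G" "g' \<in> carrier G"
  shows "vtx x g = vtx x g' \<longleftrightarrow> inv g \<otimes> g' \<in> vlabel \<G> x"
  using lcoset_eq_iff[OF vertex_subgroup[OF assms(1)] assms(2,3)] by simp

lemma B_bidirected: "pair_bidirected_digraph B"
proof
  fix e assume "e \<in> parcs B"
  then have e: "(fst e, snd e) \<in> parcs B" by simp
  then show "fst e \<in> pverts B" "snd e \<in> pverts B" "fst e \<noteq> snd e"
    unfolding parcs_B_iff using vtx_in_pverts U_no_loop U_no_loop[symmetric] by auto
next
  show "symmetric (with_proj B)"
    unfolding symmetric_def sym_def by (auto simp: parcs_B_iff)
qed

text \<open>For fixed \<open>g\<close>, the cosets of \<open>g\<close> form a translate of the underlying tree.\<close>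

lemma B_connected_fixed_coset:
  assumes "x \<in> verts U" "y \<in> verts U" "g \<in> carrier G"
  shows "(vtx x g, vtx y g) \<in> (parcs B)\<^sup>*"
proof -
  have "(x, y) \<in> (ends U (arcs U))\<^sup>*"
    using U.tree_connected[of x y] assms by (simp add: parcs_U)
  then show ?thesis
  proof induction
    case (step y z)
    then have "(vtx y g, vtx z g) \<in> parcs B"
      using assms(3) unfolding parcs_B_iff ends_def by auto
    with step.IH show ?case by (rule rtrancl_into_rtrancl)
  qed simp
qed

text \<open>The translates of the underlying tree by \<open>g\<close> and by \<open>g h\<close> share a vertex if \<open>h\<close> lies in a vertex group,
  and these elements generate \<open>G\<close>.\<close>

lemma B_connected:
  assumes x: "x \<in> verts U" and "h \<in> generate G (\<Union>x\<in>verts U. vlabel \<G> x)" "g \<in> carrier G"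
  shows "(vtx x g, vtx x (g \<otimes> h)) \<in> (parcs B)\<^sup>*"
proof -
  have in_vertex_group: "(vtx x g, vtx x (g \<otimes> h)) \<in> (parcs B)\<^sup>*"
    if y: "y \<in> verts U" "h \<in> vlabel \<G> y" and g: "g \<in> carrier G" for y h g
  proof -
    have h: "h \<in> carrier G" using y by (rule vertex_mem_carrier)
    then have "vtx y g = vtx y (g \<otimes> h)"
      using y g by (subst vtx_eq_iff) (simp_all flip: m_assoc)
    then show ?thesis
      using B_connected_fixed_coset[OF x y(1) g] B_connected_fixed_coset[OF y(1) x, of "g \<otimes> h"] g h
      by (metis m_closed rtrancl_trans)
  qed
  have V: "(\<Union>x\<in>verts U. vlabel \<G> x) \<subseteq> carrier G" using vertex_carrier by blast
  show ?thesis
    using assms(2,3)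
  proof (induction arbitrary: g)
    case (inv h)
    then obtain y where "y \<in> verts U" "inv h \<in> vlabel \<G> y"
      using vertex_subgroup by (blast intro: subgroup.m_inv_closed)
    with inv.prems show ?case by (intro in_vertex_group)
  next
    case (eng h1 h2)
    note h = eng.hyps[THEN generate_in_carrier[OF V]]
    have "(vtx x g, vtx x (g \<otimes> h1)) \<in> (parcs B)\<^sup>*" "(vtx x (g \<otimes> h1), vtx x (g \<otimes> h1 \<otimes> h2)) \<in> (parcs B)\<^sup>*"
      using eng.IH eng.prems h by auto
    then show ?case using eng.prems h by (simp add: m_assoc)
  qed (use in_vertex_group in auto)
qed

text \<open>The edge \<open>g G\<^sub>e\<close> is the only one of the Bass--Serre tree across which the function \<open>F\<close> changes:
  it is the value at \<open>g\<close> of a cocycle that counts separating translates of the edge \<open>e\<close>.\<close>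

lemma B_halfspace:
  assumes e: "e \<in> arcs U" and g: "g \<in> carrier G"
  shows "\<exists>H. vtx (tail U e) g \<in> H \<and> vtx (head U e) g \<notin> H \<and>
    (\<forall>p q. (p, q) \<in> parcs B \<longrightarrow> {p, q} \<noteq> {vtx (tail U e) g, vtx (head U e) g} \<longrightarrow>
      (p \<in> H \<longleftrightarrow> q \<in> H))"
proof -
  let ?E = "elabel \<G> e"
  interpret E: subgroup ?E G using e by (rule edge_subgroup)
  obtain A b where A: "halfspace_at e A" and b: "wall_cocycle e A b"
    using halfspace_at_exists[OF e] wall_cocycle_exists[OF e] by metis
  define F where "F x k = b k g + (if x \<in> A then 0 else of_bool (inv k \<otimes> g \<in> ?E))" for x k
  have F_coset: "F x (k \<otimes> h) = F x k" if "x \<in> verts U" "k \<in> carrier G" "h \<in> vlabel \<G> x" for x k h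
  proof -
    have "h \<in> carrier G" using that(1,3) by (rule vertex_mem_carrier)
    then show ?thesis
      using that g wall_cocycle_mult[OF b, of k h g] wall_cocycle_vertex[OF b, of x h "inv k \<otimes> g"]
      by (simp add: F_def inv_mult_group m_assoc)
  qed
  define H where "H = {(x, C). \<exists>k\<in>C. F x k = b g g}"
  have H_iff: "vtx x k \<in> H \<longleftrightarrow> F x k = b g g" if x: "x \<in> verts U" and k: "k \<in> carrier G" for x k
  proof -
    have "\<one> \<in> vlabel \<G> x" using vertex_subgroup[OF x] by (rule subgroup.one_closed)
    then have "vtx x k \<in> H \<longleftrightarrow> (\<exists>h\<in>vlabel \<G> x. F x (k \<otimes> h) = b g g)"
      by (auto simp: H_def l_coset_def)
    also have "\<dots> \<longleftrightarrow> F x k = b g g" using F_coset[OF x k] \<open>\<one> \<in> vlabel \<G> x\<close> by auto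
    finally show ?thesis .
  qed
  have base: "vtx (tail U e) g \<in> H" "vtx (head U e) g \<notin> H"
    using A e g by (simp_all add: H_iff F_def halfspace_at_def)
  have other: "vtx (tail U e') k \<in> H \<longleftrightarrow> vtx (head U e') k \<in> H"
    if e': "e' \<in> arcs U" and k: "k \<in> carrier G"
      and ne: "{vtx (tail U e') k, vtx (head U e') k} \<noteq> {vtx (tail U e) g, vtx (head U e) g}" for e' k
  proof (cases "e' = e")
    case True
    have "inv k \<otimes> g \<notin> ?E"
    proof
      assume "inv k \<otimes> g \<in> ?E"
      then have "vtx (tail U e) k = vtx (tail U e) g" "vtx (head U e) k = vtx (head U e) g"
        using e g k edge_subset_tail[OF e] edge_subset_head[OF e]
          vtx_eq_iff[of "tail U e" k g] vtx_eq_iff[of "head U e" k g] by auto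
      with ne True show False by simp
    qed
    with True e k show ?thesis by (simp add: H_iff F_def)
  next
    case False
    with A e' k show ?thesis by (simp add: H_iff F_def halfspace_at_def)
  qed
  have "p \<in> H \<longleftrightarrow> q \<in> H"
    if pq: "(p, q) \<in> parcs B" "{p, q} \<noteq> {vtx (tail U e) g, vtx (head U e) g}" for p q
  proof -
    obtain e' k where e': "e' \<in> arcs U" "k \<in> carrier G" and
      ends: "p = vtx (tail U e') k \<and> q = vtx (head U e') k \<or>
        p = vtx (head U e') k \<and> q = vtx (tail U e') k"
      using pq(1) unfolding parcs_B_iff by blast
    have "{p, q} = {vtx (tail U e') k, vtx (head U e') k}"
      using ends by (elim disjE conjE) (simp_all only: insert_commute)
    with other[OF e'] pq(2) have "vtx (tail U e') k \<in> H \<longleftrightarrow> vtx (head U e') k \<in> H" by simp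
    with ends show ?thesis by (elim disjE conjE) simp_all
  qed
  with base show ?thesis by (intro exI[of _ H]) simp
qed

lemma B_tree: "simplicial_tree B"
  unfolding simplicial_tree_iff_halfspaces
proof (intro conjI allI impI)
  interpret B: pair_bidirected_digraph B by (rule B_bidirected)
  show "pair_bidirected_digraph B" by (rule B_bidirected)
  show "Digraph_Component.connected (with_proj B)"
    unfolding connected_with_proj_iff[OF B.pair_sym_digraph_axioms]
  proof (intro conjI ballI)
    show "pverts B \<noteq> {}" using U.tree_nonempty vtx_in_pverts one_closed by fastforce
    fix p q assume "p \<in> pverts B" "q \<in> pverts B"
    then obtain x y g h where pq: "p = vtx x g" "q = vtx y h" "x \<in> verts U" "y \<in> verts U"
      "g \<in> carrier G" "h \<in> carrier G"
      unfolding pverts_B by blast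
    have "(vtx x g, vtx x (g \<otimes> (inv g \<otimes> h))) \<in> (parcs B)\<^sup>*"
      using pq by (intro B_connected) (simp_all add: generated_by_vertex_groups)
    then have "(vtx x g, vtx x h) \<in> (parcs B)\<^sup>*" using pq by (simp flip: m_assoc)
    also have "(vtx x h, vtx y h) \<in> (parcs B)\<^sup>*" using pq by (intro B_connected_fixed_coset)
    finally show "(p, q) \<in> (parcs B)\<^sup>*" using pq by simp
  qed
  fix p q assume "(p, q) \<in> parcs B"
  then obtain e g where e: "e \<in> arcs U" "g \<in> carrier G" and
    "p = vtx (tail U e) g \<and> q = vtx (head U e) g \<or> p = vtx (head U e) g \<and> q = vtx (tail U e) g"
    unfolding parcs_B_iff by blast
  moreover obtain H where "vtx (tail U e) g \<in> H" "vtx (head U e) g \<notin> H"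
    and H: "\<And>r s. (r, s) \<in> parcs B \<Longrightarrow> {r, s} \<noteq> {vtx (tail U e) g, vtx (head U e) g} \<Longrightarrow>
      r \<in> H \<longleftrightarrow> s \<in> H"
    using B_halfspace[OF e] by (elim exE conjE) (rule that, assumption+, blast)
  ultimately consider "p \<in> H" "q \<notin> H" "{p, q} = {vtx (tail U e) g, vtx (head U e) g}"
    | "p \<in> - H" "q \<notin> - H" "{p, q} = {vtx (tail U e) g, vtx (head U e) g}"
    by auto
  then show "\<exists>H. p \<in> H \<and> q \<notin> H \<and>
      (\<forall>r s. (r, s) \<in> parcs B \<longrightarrow> {r, s} \<noteq> {p, q} \<longrightarrow> (r \<in> H \<longleftrightarrow> s \<in> H))"
  proof cases
    case 1
    with H show ?thesis by (intro exI[of _ H]) simp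
  next
    case 2
    with H show ?thesis by (intro exI[of _ "- H"]) simp
  qed
qed

lemma act_vtx:
  assumes "x \<in> verts U" "g \<in> carrier G" "h \<in> carrier G"
  shows "act h (vtx x g) = vtx x (h \<otimes> g)"
  using vtx_in_pverts[OF assms(1,2)] lcos_m_assoc[OF vertex_carrier[OF assms(1)] assms(3,2)]
  by (simp add: bass_serre_action_def)

lemma B_group_action: "group_action G (pverts B) act"
proof -
  have closed: "act h p \<in> pverts B" if "h \<in> carrier G" "p \<in> pverts B" for h p
  proof -
    obtain x g where p: "p = vtx x g" "x \<in> verts U" "g \<in> carrier G"
      using \<open>p \<in> pverts B\<close> unfolding pverts_B by blast
    show ?thesis using act_vtx[OF p(2,3) \<open>h \<in> carrier G\<close>] vtx_in_pverts p \<open>h \<in> carrier G\<close> by simp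
  qed
  have inverse: "act (inv h) (act h p) = p" if "h \<in> carrier G" "p \<in> pverts B" for h p
    using that unfolding pverts_B by (auto simp: act_vtx simp flip: m_assoc)
  have Bij: "act h \<in> Bij (pverts B)" if h: "h \<in> carrier G" for h
  proof -
    have "act h (act (inv h) p) = p" if "p \<in> pverts B" for p
      using inverse[of "inv h" p] h that by simp
    then have "bij_betw (act h) (pverts B) (pverts B)"
      using inverse[OF h] closed h by (intro bij_betw_byWitness[of _ "act (inv h)"]) auto
    then show ?thesis by (simp add: Bij_def) (simp add: bass_serre_action_def)
  qed
  have "act (h \<otimes> k) = compose (pverts B) (act h) (act k)"
    if hk: "h \<in> carrier G" "k \<in> carrier G" for h k
  proof (rule extensionalityI)
    fix p assume p: "p \<in> pverts B"
    then obtain x g where xg: "p = vtx x g" "x \<in> verts U" "g \<in> carrier G" unfolding pverts_B by blast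
    have "act (h \<otimes> k) p = vtx x (h \<otimes> k \<otimes> g)" using hk xg by (simp only: act_vtx m_closed)
    also have "\<dots> = act h (act k p)" using hk xg by (simp only: act_vtx m_closed m_assoc)
    also have "\<dots> = compose (pverts B) (act h) (act k) p" using p by (simp add: compose_def)
    finally show "act (h \<otimes> k) p = compose (pverts B) (act h) (act k) p" .
  qed (simp_all add: bass_serre_action_def)
  then have "act \<in> hom G (BijGroup (pverts B))"
    using Bij by (intro homI) (simp_all add: BijGroup_def)
  then show ?thesis
    by (simp add: group_action_def group_hom_def group_hom_axioms_def group_BijGroup is_group)
qed

lemma B_tree_action: "tree_action G B act"
  unfolding tree_action_def
proof (intro conjI ballI)
  show "simplicial_tree B" by (rule B_tree)
  show "group_action G (pverts B) act" by (rule B_group_action)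
  fix h pq assume h: "h \<in> carrier G" and pq: "pq \<in> parcs B"
  obtain p q where [simp]: "pq = (p, q)" by (cases pq)
  obtain e g where e: "e \<in> arcs U" and g: "g \<in> carrier G" and
    "p = vtx (tail U e) g \<and> q = vtx (head U e) g \<or> p = vtx (head U e) g \<and> q = vtx (tail U e) g"
    using pq by (auto simp: parcs_B_iff)
  moreover have "(vtx (tail U e) (h \<otimes> g), vtx (head U e) (h \<otimes> g)) \<in> parcs B"
    "(vtx (head U e) (h \<otimes> g), vtx (tail U e) (h \<otimes> g)) \<in> parcs B"
    unfolding parcs_B_iff using e g h by blast+
  moreover have "act h (vtx (tail U e) g) = vtx (tail U e) (h \<otimes> g)"
    "act h (vtx (head U e) g) = vtx (head U e) (h \<otimes> g)"
    using e g h by (simp_all only: act_vtx tail_in_verts head_in_verts)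
  ultimately show "case pq of (p, q) \<Rightarrow> (act h p, act h q) \<in> parcs B"
    "case pq of (p, q) \<Rightarrow> \<not> (act h p = q \<and> act h q = p)"
    using U_no_loop[OF e] by (auto simp del: prod.inject)
qed

sublocale B: group_on_tree G B act
  by unfold_locales (rule B_tree, rule B_tree_action)

lemma vertex_stabilizer_eq_conjugate:
  assumes "x \<in> verts U" "g \<in> carrier G"
  shows "stabilizer G act (vtx x g) = {h \<in> carrier G. inv g \<otimes> h \<otimes> g \<in> vlabel \<G> x}"
proof -
  have "act h (vtx x g) = vtx x g \<longleftrightarrow> inv g \<otimes> h \<otimes> g \<in> vlabel \<G> x" if h: "h \<in> carrier G" for h
  proof -
    have "act h (vtx x g) = vtx x g \<longleftrightarrow> vtx x g = vtx x (h \<otimes> g)"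
      unfolding act_vtx[OF assms h] by (rule eq_commute)
    also have "\<dots> \<longleftrightarrow> inv g \<otimes> (h \<otimes> g) \<in> vlabel \<G> x"
      using assms h by (intro vtx_eq_iff) simp_all
    finally show ?thesis using assms h by (simp add: m_assoc)
  qed
  then show ?thesis by (auto simp: stabilizer_def)
qed

text \<open>An edge stabilizer is the intersection of the stabilizers of the two ends, hence a conjugate of the
  intersection of the two vertex groups.\<close>

lemma edge_stabilizer_eq_conjugate:
  assumes "a \<in> parcs B"
  shows "\<exists>e\<in>arcs U. \<exists>g\<in>carrier G.
    edge_stabilizer G act a = {h \<in> carrier G. inv g \<otimes> h \<otimes> g \<in> elabel \<G> e}"
proof -
  have "(fst a, snd a) \<in> parcs B" using assms by simp
  then obtain e g where e: "e \<in> arcs U" "g \<in> carrier G" and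
    "fst a = vtx (tail U e) g \<and> snd a = vtx (head U e) g \<or>
     fst a = vtx (head U e) g \<and> snd a = vtx (tail U e) g"
    unfolding parcs_B_iff by blast
  then have "edge_stabilizer G act a =
      stabilizer G act (vtx (tail U e) g) \<inter> stabilizer G act (vtx (head U e) g)"
    by (auto simp: edge_stabilizer_def)
  also have "\<dots> = {h \<in> carrier G. inv g \<otimes> h \<otimes> g \<in> vlabel \<G> (tail U e) \<inter> vlabel \<G> (head U e)}"
    using e by (auto simp: vertex_stabilizer_eq_conjugate)
  finally show ?thesis using e vertex_groups_meet_in_edge_group[OF e(1)] by auto
qed

lemma vertex_group_elliptic:
  assumes "x \<in> verts U"
  shows "elliptic B act (vlabel \<G> x)"
proof -
  have "act h (vtx x \<one>) = vtx x \<one>" if h: "h \<in> vlabel \<G> x" for h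
  proof -
    have "h \<in> stabilizer G act (vtx x \<one>)"
      unfolding vertex_stabilizer_eq_conjugate[OF assms one_closed] using h vertex_mem_carrier[OF assms h] by simp
    then show ?thesis unfolding stabilizer_def by blast
  qed
  then show ?thesis using vtx_in_pverts[OF assms one_closed] by (auto simp: elliptic_def)
qed

end

section \<open>Splittings as tree decompositions of graphs\<close>

text \<open>A tree decomposition of the subgraph induced by \<open>S\<close>, whose parts are the vertex labels. That the
  underlying graph is a tree is expressed by connectedness and the number of edges, which are easy to
  follow when a vertex is replaced. In the condition \<open>subtree\<close>, the places where \<open>v\<close> occurs are connected by
  edges whose own label contains \<open>v\<close>, since it is along these that copies of the generator \<open>v\<close> are
  identified.\<close>

locale tree_decomposition =
  fixes \<Gamma> :: "'v pair_pre_digraph" and S :: "'v set" and \<Lambda> :: "'v splitting"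
  assumes wf: "wf_digraph (ugraph \<Lambda>)"
    and finite_verts: "finite (verts (ugraph \<Lambda>))"
    and finite_arcs: "finite (arcs (ugraph \<Lambda>))"
    and card: "card (verts (ugraph \<Lambda>)) = Suc (card (arcs (ugraph \<Lambda>)))"
    and conn: "\<And>x y. x \<in> verts (ugraph \<Lambda>) \<Longrightarrow> y \<in> verts (ugraph \<Lambda>) \<Longrightarrow>
      (x, y) \<in> (ends (ugraph \<Lambda>) (arcs (ugraph \<Lambda>)))\<^sup>*"
    and cover: "(\<Union>x\<in>verts (ugraph \<Lambda>). vlabel \<Lambda> x) = S"
    and edge_cover: "\<And>u v. u \<in> S \<Longrightarrow> v \<in> S \<Longrightarrow> (u, v) \<in> parcs \<Gamma> \<Longrightarrow>
      \<exists>x\<in>verts (ugraph \<Lambda>). u \<in> vlabel \<Lambda> x \<and> v \<in> vlabel \<Lambda> x"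
    and clique: "\<And>e. e \<in> arcs (ugraph \<Lambda>) \<Longrightarrow> clique \<Gamma> (elabel \<Lambda> e)"
    and subset_tail: "\<And>e. e \<in> arcs (ugraph \<Lambda>) \<Longrightarrow> elabel \<Lambda> e \<subseteq> vlabel \<Lambda> (tail (ugraph \<Lambda>) e)"
    and subset_head: "\<And>e. e \<in> arcs (ugraph \<Lambda>) \<Longrightarrow> elabel \<Lambda> e \<subseteq> vlabel \<Lambda> (head (ugraph \<Lambda>) e)"
    and subtree: "\<And>v x y. x \<in> verts (ugraph \<Lambda>) \<Longrightarrow> y \<in> verts (ugraph \<Lambda>) \<Longrightarrow> v \<in> vlabel \<Lambda> x \<Longrightarrow>
      v \<in> vlabel \<Lambda> y \<Longrightarrow> (x, y) \<in> (ends (ugraph \<Lambda>) {e \<in> arcs (ugraph \<Lambda>). v \<in> elabel \<Lambda> e})\<^sup>*"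

lemmas tree_decompositionD = tree_decomposition.wf tree_decomposition.finite_verts
  tree_decomposition.finite_arcs tree_decomposition.card tree_decomposition.conn
  tree_decomposition.cover tree_decomposition.edge_cover tree_decomposition.clique
  tree_decomposition.subset_tail tree_decomposition.subset_head tree_decomposition.subtree

text \<open>\<open>R y\<close> consists of the vertices that take the place of \<open>y\<close>. It is connected for every \<open>y\<close>, so a walk in
  the old graph can be followed in the new one, wherever the edges at \<open>x\<close> are reattached. This is used
  for the whole graph, and for the part of it where a given vertex of \<open>\<Gamma>\<close> occurs.\<close>

lemma replaced_vertex_connected:
  assumes R: "R = (\<lambda>y. if y = x then N else {y})"
    and N: "\<And>y y'. y \<in> N \<Longrightarrow> y' \<in> N \<Longrightarrow> (y, y') \<in> (ends U' F)\<^sup>*"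
    and reattached: "\<And>e. e \<in> E \<Longrightarrow> tail U' e \<in> R (tail U e) \<and> head U' e \<in> R (head U e)"
    and pq: "(p, q) \<in> (ends U E)\<^sup>*" "p' \<in> R p" "q' \<in> R q"
  shows "(p', q') \<in> (ends U' (E \<union> F))\<^sup>*"
proof -
  have R_conn: "(y, y') \<in> (ends U' (E \<union> F))\<^sup>*" if "y \<in> R z" "y' \<in> R z" for y y' z
    using that N[of y y'] rtrancl_mono[OF ends_mono[of F "E \<union> F" U']]
    by (auto simp: R split: if_splits)
  from pq(1,3) show ?thesis
  proof (induction arbitrary: q')
    case base
    then show ?case using pq(2) R_conn by blast
  next
    case (step q s)
    then obtain e where e: "e \<in> E"
      "q = tail U e \<and> s = head U e \<or> q = head U e \<and> s = tail U e"
      by (auto simp: ends_def)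
    obtain y z where yz: "y \<in> R q" "z \<in> R s" "(y, z) \<in> ends U' (E \<union> F)"
      using e reattached[OF e(1)] by (auto simp: ends_def)
    have "(p', y) \<in> (ends U' (E \<union> F))\<^sup>*" using step.IH yz(1) .
    also have "(y, z) \<in> (ends U' (E \<union> F))\<^sup>*" using yz(3) by (rule r_into_rtrancl)
    also have "(z, q') \<in> (ends U' (E \<union> F))\<^sup>*" using R_conn yz(2) step.prems .
    finally show ?case .
  qed
qed

lemma ends_cong:
  "(\<And>e. e \<in> E \<Longrightarrow> tail U e = tail U' e \<and> head U e = head U' e) \<Longrightarrow> ends U E = ends U' E"
  by (simp add: ends_def)

text \<open>An edge with clique \<open>C\<close> at \<open>x\<close> is reattached to a vertex whose label contains \<open>C\<close>. So an edge that
  carries \<open>v\<close> still ends at vertices that carry \<open>v\<close>, and the places of \<open>v\<close> remain connected.\<close>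

lemma tree_decomposition_replace_vertex:
  assumes \<Lambda>: "tree_decomposition \<Gamma> S \<Lambda>" and M: "tree_decomposition \<Gamma> (vlabel \<Lambda> x) M"
    and "replace_vertex \<Lambda> x M \<Lambda>'"
  shows "tree_decomposition \<Gamma> S \<Lambda>'"
proof -
  define U W U' where "U = ugraph \<Lambda>" and "W = ugraph M" and "U' = ugraph \<Lambda>'"
  note \<Lambda> = tree_decompositionD[OF \<Lambda>, folded U_def]
  note M = tree_decompositionD[OF M, folded W_def]
  have x: "x \<in> verts U" and disj: "(verts U - {x}) \<inter> verts W = {}" "arcs U \<inter> arcs W = {}"
    and verts: "verts U' = (verts U - {x}) \<union> verts W" and arcs: "arcs U' = arcs U \<union> arcs W"
    and vold: "\<And>y. y \<in> verts U - {x} \<Longrightarrow> vlabel \<Lambda>' y = vlabel \<Lambda> y"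
    and vnew: "\<And>y. y \<in> verts W \<Longrightarrow> vlabel \<Lambda>' y = vlabel M y"
    and eold: "\<And>e. e \<in> arcs U \<Longrightarrow> elabel \<Lambda>' e = elabel \<Lambda> e"
    and tail: "\<And>e. e \<in> arcs U \<Longrightarrow> if tail U e = x
      then tail U' e \<in> verts W \<and> elabel \<Lambda> e \<subseteq> vlabel M (tail U' e) else tail U' e = tail U e"
    and head: "\<And>e. e \<in> arcs U \<Longrightarrow> if head U e = x
      then head U' e \<in> verts W \<and> elabel \<Lambda> e \<subseteq> vlabel M (head U' e) else head U' e = head U e"
    and enew: "\<And>e. e \<in> arcs W \<Longrightarrow> elabel \<Lambda>' e = elabel M e"
    and new_ends: "\<And>e. e \<in> arcs W \<Longrightarrow> tail U' e = tail W e \<and> head U' e = head W e"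
    using assms(3) unfolding replace_vertex_def Let_def U_def W_def U'_def by blast+
  interpret U: wf_digraph U by (rule \<Lambda>(1))
  interpret W: wf_digraph W by (rule M(1))
  have ne: "verts W \<noteq> {}" using M(4) by auto
  have vsub: "vlabel \<Lambda>' y \<subseteq> vlabel \<Lambda> x" if "y \<in> verts W" for y
    using vnew[OF that] M(6) that by blast
  \<comment> \<open>the old vertex whose place \<open>y\<close> takes\<close>
  have origin: "\<exists>z\<in>verts U. y \<in> (if z = x then verts W else {z}) \<and> vlabel \<Lambda>' y \<subseteq> vlabel \<Lambda> z"
    if "y \<in> verts U'" for y
    using that x vsub vold unfolding verts
    by (cases "y \<in> verts W") (auto intro: bexI[of _ x] bexI[of _ y])
  show ?thesis
  proof (rule tree_decomposition.intro, unfold U'_def[symmetric])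
    show "wf_digraph U'"
    proof
      fix e assume "e \<in> arcs U'"
      then show "tail U' e \<in> verts U'" "head U' e \<in> verts U'"
        using tail[of e] head[of e] new_ends[of e] U.tail_in_verts[of e] U.head_in_verts[of e]
        unfolding arcs verts by (auto split: if_splits)
    qed
    show "finite (verts U')" "finite (arcs U')" using \<Lambda>(2,3) M(2,3) by (simp_all add: verts arcs)
    have "card (verts U') = card (verts U) - 1 + card (verts W)"
      using disj(1) x \<Lambda>(2) M(2) by (simp add: verts card_Un_disjoint card_Diff_singleton)
    moreover have "card (arcs U') = card (arcs U) + card (arcs W)"
      using disj(2) \<Lambda>(3) M(3) by (simp add: arcs card_Un_disjoint)
    ultimately show "card (verts U') = Suc (card (arcs U'))" using \<Lambda>(4) M(4) by simp
  next
    fix y y' assume "y \<in> verts U'" "y' \<in> verts U'"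
    then obtain z z' where z: "z \<in> verts U" "y \<in> (if z = x then verts W else {z})"
      and z': "z' \<in> verts U" "y' \<in> (if z' = x then verts W else {z'})"
      using origin by meson
    have "ends U' (arcs W) = ends W (arcs W)" using new_ends by (intro ends_cong) auto
    then show "(y, y') \<in> (ends U' (arcs U'))\<^sup>*"
      unfolding arcs using \<Lambda>(5)[OF z(1) z'(1)] z(2) z'(2) M(5) tail head
      by (intro replaced_vertex_connected[OF HOL.refl, where U = U and x = x and N = "verts W"
            and p = z and q = z']) (auto split: if_splits)
  next
    have "(\<Union>y\<in>verts U'. vlabel \<Lambda>' y) = (\<Union>y\<in>verts U - {x}. vlabel \<Lambda> y) \<union> (\<Union>y\<in>verts W. vlabel M y)"
      unfolding verts using vold vnew by (simp add: UN_Un)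
    also have "\<dots> = (\<Union>y\<in>verts U. vlabel \<Lambda> y)" unfolding M(6) using x by blast
    finally show "(\<Union>y\<in>verts U'. vlabel \<Lambda>' y) = S" by (simp only: \<Lambda>(6))
  next
    fix u v assume uv: "u \<in> S" "v \<in> S" "(u, v) \<in> parcs \<Gamma>"
    then obtain y where y: "y \<in> verts U" "u \<in> vlabel \<Lambda> y" "v \<in> vlabel \<Lambda> y" using \<Lambda>(7) by blast
    show "\<exists>y\<in>verts U'. u \<in> vlabel \<Lambda>' y \<and> v \<in> vlabel \<Lambda>' y"
    proof (cases "y = x")
      case True
      with y M(7) uv(3) obtain w where "w \<in> verts W" "u \<in> vlabel M w" "v \<in> vlabel M w" by blast
      then show ?thesis using vnew verts by auto
    next
      case False
      then show ?thesis using y vold verts by auto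
    qed
  next
    fix e assume e: "e \<in> arcs U'"
    then show "clique \<Gamma> (elabel \<Lambda>' e)" using eold enew \<Lambda>(8) M(8) unfolding arcs by auto
    show "elabel \<Lambda>' e \<subseteq> vlabel \<Lambda>' (tail U' e)"
    proof (cases "e \<in> arcs W")
      case True
      then show ?thesis using enew new_ends vnew M(9) by simp
    next
      case False
      with e have e: "e \<in> arcs U" by (simp add: arcs)
      then show ?thesis
        using tail[OF e] eold[OF e] vnew vold[of "tail U e"] \<Lambda>(9)[OF e] by (auto split: if_splits)
    qed
    show "elabel \<Lambda>' e \<subseteq> vlabel \<Lambda>' (head U' e)"
    proof (cases "e \<in> arcs W")
      case True
      then show ?thesis using enew new_ends vnew M(10) by simp
    next
      case False
      with e have e: "e \<in> arcs U" by (simp add: arcs)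
      then show ?thesis
        using head[OF e] eold[OF e] vnew vold[of "head U e"] \<Lambda>(10)[OF e] by (auto split: if_splits)
    qed
  next
    fix v y y' assume y: "y \<in> verts U'" "v \<in> vlabel \<Lambda>' y" and y': "y' \<in> verts U'" "v \<in> vlabel \<Lambda>' y'"
    let ?W = "{w \<in> verts W. v \<in> vlabel M w}"
    let ?E = "{e \<in> arcs U. v \<in> elabel \<Lambda> e}" and ?F = "{e \<in> arcs W. v \<in> elabel M e}"
    have origin': "\<exists>z\<in>verts U. v \<in> vlabel \<Lambda> z \<and> y \<in> (if z = x then ?W else {z})"
      if "y \<in> verts U'" "v \<in> vlabel \<Lambda>' y" for y
      using origin[OF that(1)] that vnew[of y] by (fastforce split: if_splits)
    obtain z z' where z: "z \<in> verts U" "v \<in> vlabel \<Lambda> z" "y \<in> (if z = x then ?W else {z})"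
      and z': "z' \<in> verts U" "v \<in> vlabel \<Lambda> z'" "y' \<in> (if z' = x then ?W else {z'})"
      using origin'[OF y] origin'[OF y'] by blast
    have new: "ends U' ?F = ends W ?F" using new_ends by (intro ends_cong) auto
    have "(y, y') \<in> (ends U' (?E \<union> ?F))\<^sup>*"
    proof (rule replaced_vertex_connected[OF HOL.refl, where U = U and x = x and N = ?W
            and p = z and q = z'])
      show "(w, w') \<in> (ends U' ?F)\<^sup>*" if "w \<in> ?W" "w' \<in> ?W" for w w'
        using that M(11) by (simp add: new)
      show "tail U' e \<in> (if tail U e = x then ?W else {tail U e}) \<and>
          head U' e \<in> (if head U e = x then ?W else {head U e})" if "e \<in> ?E" for e
        using that tail[of e] head[of e] by (auto split: if_splits)
    qed (use \<Lambda>(11)[OF z(1) z'(1) z(2) z'(2)] z(3) z'(3) in simp_all)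
    moreover have "{e \<in> arcs U'. v \<in> elabel \<Lambda>' e} = ?E \<union> ?F"
      using eold enew by (auto simp: arcs)
    ultimately show "(y, y') \<in> (ends U' {e \<in> arcs U'. v \<in> elabel \<Lambda>' e})\<^sup>*" by simp
  qed
qed

lemma tree_decomposition_trivial:
  assumes "trivial_splitting S \<Lambda>"
  shows "tree_decomposition \<Gamma> S \<Lambda>"
  using assms
  by (auto simp: trivial_splitting_def intro!: tree_decomposition.intro wf_digraph.intro)

text \<open>Finite simplicial graphs, with the graph called \<open>\<Gamma>\<close> to leave \<open>G\<close> for groups.\<close>

locale finite_graph = pair_graph \<Gamma> for \<Gamma> :: "'v pair_pre_digraph"
begin

lemma parcs_induced: "arcs_ends (with_proj \<Gamma> \<restriction> S) = {(u, v) \<in> parcs \<Gamma>. u \<in> S \<and> v \<in> S}"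
  by (auto simp: arcs_ends_def arc_to_ends_def induce_subgraph_def image_iff)

lemma components_subset: "D \<in> components \<Gamma> S \<Longrightarrow> D \<subseteq> S"
  and components_cover: "\<Union>(components \<Gamma> S) = S"
  and components_disjoint: "D \<in> components \<Gamma> S \<Longrightarrow> D' \<in> components \<Gamma> S \<Longrightarrow> D \<noteq> D' \<Longrightarrow> D \<inter> D' = {}"
proof -
  interpret S: wf_digraph "with_proj \<Gamma> \<restriction> S" by (rule wellformed_induce_subgraph)
  show "D \<subseteq> S" if "D \<in> components \<Gamma> S" for D
    using S.sccs_verts_subsets[of D] that by (simp add: components_def)
  then show "\<Union>(components \<Gamma> S) = S"
    using S.scc_of_in_sccs_verts S.in_scc_of_self by (fastforce simp: components_def)
  show "D \<in> components \<Gamma> S \<Longrightarrow> D' \<in> components \<Gamma> S \<Longrightarrow> D \<noteq> D' \<Longrightarrow> D \<inter> D' = {}"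
    unfolding components_def by (rule S.sccs_verts_disjoint)
qed

lemma components_adjacent:
  assumes "D \<in> components \<Gamma> S" "u \<in> D" "v \<in> S" "(u, v) \<in> parcs \<Gamma>"
  shows "v \<in> D"
proof -
  interpret S: wf_digraph "with_proj \<Gamma> \<restriction> S" by (rule wellformed_induce_subgraph)
  have "u \<rightarrow>\<^bsub>with_proj \<Gamma> \<restriction> S\<^esub> v" "v \<rightarrow>\<^bsub>with_proj \<Gamma> \<restriction> S\<^esub> u"
    using assms components_subset[OF assms(1)] arcs_symmetric by (auto simp: parcs_induced)
  then have "u \<rightarrow>\<^sup>*\<^bsub>with_proj \<Gamma> \<restriction> S\<^esub> v" "v \<rightarrow>\<^sup>*\<^bsub>with_proj \<Gamma> \<restriction> S\<^esub> u" 
    using S.reachable_adjI by metis+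
  with assms(1,2) show ?thesis unfolding components_def S.sccs_verts_def by blast
qed

lemma finite_components:
  assumes "finite S"
  shows "finite (components \<Gamma> S)"
proof (rule finite_subset)
  show "components \<Gamma> S \<subseteq> Pow S" by (intro subsetI PowI components_subset)
qed (simp add: assms)

text \<open>An edge of the subgraph that does not lie in \<open>K\<close> has an end in some component \<open>D\<close> of \<open>S - K\<close>, and
  its other end is then in \<open>D \<union> K\<close>. A vertex in \<open>K\<close> occurs everywhere, any other one only at the leaf of
  its component.\<close>

lemma tree_decomposition_star:
  assumes S: "finite S" and K: "K \<subseteq> S" "clique \<Gamma> K" and "star_splitting \<Gamma> S K \<Lambda>"
  shows "tree_decomposition \<Gamma> S \<Lambda>"
proof -
  let ?C = "components \<Gamma> (S - K)"
  define U where "U = ugraph \<Lambda>"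
  obtain c leaf edge where inj: "inj_on leaf ?C" "c \<notin> leaf ` ?C" "inj_on edge ?C"
    and verts: "verts U = insert c (leaf ` ?C)" and arcs: "arcs U = edge ` ?C"
    and c: "vlabel \<Lambda> c = K"
    and labels: "\<And>D. D \<in> ?C \<Longrightarrow> vlabel \<Lambda> (leaf D) = D \<union> K \<and> elabel \<Lambda> (edge D) = K \<and>
      tail U (edge D) = c \<and> head U (edge D) = leaf D"
    using assms(4) unfolding star_splitting_def Let_def U_def[symmetric]
    by (elim exE conjE) (rule that, assumption+, rule bspec)
  have fin: "finite ?C" using S by (intro finite_components) simp
  have conn: "(x, y) \<in> (ends U E)\<^sup>*"
    if "x \<in> insert c (leaf ` A)" "y \<in> insert c (leaf ` A)" "A \<subseteq> ?C" "edge ` A \<subseteq> E" for x y A E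
  proof -
    have leaf: "(c, leaf D) \<in> (ends U E)\<^sup>*" "(leaf D, c) \<in> (ends U E)\<^sup>*" if "D \<in> A" for D
    proof -
      have "edge D \<in> E" using \<open>D \<in> A\<close> \<open>edge ` A \<subseteq> E\<close> by blast
      moreover have "tail U (edge D) = c" "head U (edge D) = leaf D"
        using labels \<open>D \<in> A\<close> \<open>A \<subseteq> ?C\<close> by auto
      ultimately have "(c, leaf D) \<in> ends U E" "(leaf D, c) \<in> ends U E"
        unfolding ends_def by (blast intro: HOL.sym)+
      then show "(c, leaf D) \<in> (ends U E)\<^sup>*" "(leaf D, c) \<in> (ends U E)\<^sup>*"
        by (simp_all add: r_into_rtrancl)
    qed
    have "(x, c) \<in> (ends U E)\<^sup>*" "(c, y) \<in> (ends U E)\<^sup>*" using that(1,2) leaf by auto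
    then show ?thesis by (rule rtrancl_trans)
  qed
  show ?thesis
  proof (rule tree_decomposition.intro, unfold U_def[symmetric])
    show "wf_digraph U" by unfold_locales (use labels in \<open>auto simp: verts arcs\<close>)
    show "finite (verts U)" "finite (arcs U)" using fin by (simp_all add: verts arcs)
    show "card (verts U) = Suc (card (arcs U))"
      using inj fin by (simp add: verts arcs card_image)
    show "(x, y) \<in> (ends U (arcs U))\<^sup>*" if "x \<in> verts U" "y \<in> verts U" for x y
      using conn[of x ?C y "arcs U"] that by (simp add: verts arcs)
    have "(\<Union>x\<in>verts U. vlabel \<Lambda> x) = K \<union> \<Union>?C" using c labels by (auto simp: verts)
    then show "(\<Union>x\<in>verts U. vlabel \<Lambda> x) = S" using K(1) by (auto simp: components_cover)
  next
    fix u v assume uv: "u \<in> S" "v \<in> S" "(u, v) \<in> parcs \<Gamma>"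
    show "\<exists>x\<in>verts U. u \<in> vlabel \<Lambda> x \<and> v \<in> vlabel \<Lambda> x"
    proof (cases "u \<in> K \<and> v \<in> K")
      case True
      then show ?thesis using c by (auto simp: verts)
    next
      case False
      then obtain w w' where w: "{u, v} = {w, w'}" "w \<in> S - K" "w' \<in> S" "(w, w') \<in> parcs \<Gamma>"
        using uv arcs_symmetric by blast
      then obtain D where D: "D \<in> ?C" "w \<in> D" using components_cover[of "S - K"] by blast
      then have "w' \<in> D \<union> K" using components_adjacent[of D "S - K" w w'] w by blast
      then have "{u, v} \<subseteq> vlabel \<Lambda> (leaf D)" using D labels unfolding w(1) by simp
      then show ?thesis using D(1) by (auto simp: verts)
    qed
  next
    fix e assume "e \<in> arcs U"
    then show "clique \<Gamma> (elabel \<Lambda> e)" "elabel \<Lambda> e \<subseteq> vlabel \<Lambda> (tail U e)"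
      "elabel \<Lambda> e \<subseteq> vlabel \<Lambda> (head U e)"
      using labels c K by (auto simp: arcs)
  next
    fix v x y assume x: "x \<in> verts U" "v \<in> vlabel \<Lambda> x" and y: "y \<in> verts U" "v \<in> vlabel \<Lambda> y"
    let ?E = "{e \<in> arcs U. v \<in> elabel \<Lambda> e}"
    show "(x, y) \<in> (ends U ?E)\<^sup>*"
    proof (cases "v \<in> K")
      case True
      then have "edge ` ?C \<subseteq> ?E" using labels by (auto simp: arcs)
      then show ?thesis using conn[of x ?C y ?E] x y by (simp add: verts)
    next
      case False
      have leaf: "\<exists>D\<in>?C. z = leaf D \<and> v \<in> D" if "z \<in> verts U" "v \<in> vlabel \<Lambda> z" for z
        using that False c labels by (auto simp: verts)
      obtain D D' where "D \<in> ?C" "x = leaf D" "v \<in> D" "D' \<in> ?C" "y = leaf D'" "v \<in> D'"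
        using leaf[OF x] leaf[OF y] by blast
      then have "x = y" using components_disjoint[of D "S - K" D'] by blast
      then show ?thesis by simp
    qed
  qed
qed

lemma tree_decomposition_one_edge:
  assumes S: "finite S" and K: "K \<subseteq> S" "clique \<Gamma> K" and "one_edge_splitting \<Gamma> S K \<Lambda>"
  shows "tree_decomposition \<Gamma> S \<Lambda>"
proof -
  define U where "U = ugraph \<Lambda>"
  obtain D1 D2 x1 x2 e where D: "components \<Gamma> (S - K) = {D1, D2}" "D1 \<noteq> D2" and x: "x1 \<noteq> x2"
    and verts: "verts U = {x1, x2}" and arcs: "arcs U = {e}" and e: "tail U e = x1" "head U e = x2"
    and labels: "vlabel \<Lambda> x1 = D1 \<union> K" "vlabel \<Lambda> x2 = D2 \<union> K" "elabel \<Lambda> e = K"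
    using assms(4) unfolding one_edge_splitting_def Let_def U_def[symmetric]
    by (elim exE conjE) (rule that)
  have ends: "ends U {e} = {(x1, x2), (x2, x1)}" by (simp add: ends_def e)
  have cover: "D1 \<union> D2 = S - K" using components_cover[of "S - K"] D by simp
  have disj: "D1 \<inter> D2 = {}" using components_disjoint[of D1 "S - K" D2] D by simp
  have adj: "w' \<in> D1" if "w \<in> D1" "w' \<in> S - K" "(w, w') \<in> parcs \<Gamma>" for w w'
    using components_adjacent[of D1 "S - K" w w'] that D by simp
  have adj2: "w' \<in> D2" if "w \<in> D2" "w' \<in> S - K" "(w, w') \<in> parcs \<Gamma>" for w w'
    using components_adjacent[of D2 "S - K" w w'] that D by simp
  show ?thesis
  proof (rule tree_decomposition.intro, unfold U_def[symmetric])
    show "wf_digraph U" by unfold_locales (auto simp: verts arcs e)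
    show "card (verts U) = Suc (card (arcs U))" using x by (simp add: verts arcs)
    show "(\<Union>x\<in>verts U. vlabel \<Lambda> x) = S" using cover K(1) by (auto simp: verts labels)
    show "\<exists>x\<in>verts U. u \<in> vlabel \<Lambda> x \<and> v \<in> vlabel \<Lambda> x"
      if "u \<in> S" "v \<in> S" "(u, v) \<in> parcs \<Gamma>" for u v
      using that cover adj[of u v] adj[of v u] adj2[of u v] adj2[of v u] arcs_symmetric[of u v]
      by (auto simp: verts labels)
    show "(x, y) \<in> (ends U {e \<in> arcs U. v \<in> elabel \<Lambda> e})\<^sup>*"
      if "x \<in> verts U" "y \<in> verts U" "v \<in> vlabel \<Lambda> x" "v \<in> vlabel \<Lambda> y" for v x y
    proof (cases "v \<in> K")
      case True
      then have "{e \<in> arcs U. v \<in> elabel \<Lambda> e} = {e}" by (auto simp: arcs labels)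
      then show ?thesis using that(1,2) by (auto simp: ends verts)
    next
      case False
      then have "x = y" using that disj by (auto simp: verts labels)
      then show ?thesis by simp
    qed
  qed (use K(2) in \<open>auto simp: verts arcs e labels ends\<close>)
qed

lemma tree_decomposition_clique_splitting:
  assumes "finite S" "clique_splitting \<Gamma> S K \<Lambda>"
  shows "tree_decomposition \<Gamma> S \<Lambda>"
  using assms tree_decomposition_star[of S K \<Lambda>] tree_decomposition_one_edge[of S K \<Lambda>]
  by (auto simp: clique_splitting_def min_separating_clique_def separating_clique_def)

lemma vlabel_subset:
  "tree_decomposition \<Gamma> S \<Lambda> \<Longrightarrow> x \<in> verts (ugraph \<Lambda>) \<Longrightarrow> vlabel \<Lambda> x \<subseteq> S"
  using tree_decompositionD(6) by blast

lemma tree_decomposition_process: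
  assumes "process \<Gamma> S Ks \<Lambda>" "finite S"
  shows "tree_decomposition \<Gamma> S \<Lambda>"
  using assms
proof induction
  case (Nil \<Lambda>)
  then show ?case by (intro tree_decomposition_trivial)
next
  case (snoc Ks \<Lambda> x K M \<Lambda>')
  then have "finite (vlabel \<Lambda> x)" using vlabel_subset finite_subset by metis
  with snoc show ?case
    using tree_decomposition_replace_vertex tree_decomposition_clique_splitting by metis
qed

lemma tree_decomposition_iterated_splitting:
  assumes "iterated_splitting \<Gamma> \<Lambda>"
  shows "tree_decomposition \<Gamma> (pverts \<Gamma>) \<Lambda>"
  using assms
proof induction
  case (start \<Lambda>)
  then show ?case by (intro tree_decomposition_trivial)
next
  case (refine \<Lambda> x M \<Lambda>')
  then have "finite (vlabel \<Lambda> x)" using vlabel_subset finite_subset pair_finite_verts by metis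
  with refine show ?case
    using tree_decomposition_replace_vertex tree_decomposition_process
    unfolding min_clique_refinement_def by metis
qed

end

section \<open>Right-angled Artin groups\<close>

lemma (in group) word_val_commutator_iff:
  assumes "f u \<in> carrier G" "f v \<in> carrier G"
  shows "word_val G f [(u, True), (v, True), (u, False), (v, False)] = \<one> \<longleftrightarrow> f u \<otimes> f v = f v \<otimes> f u"
proof -
  have "word_val G f [(u, True), (v, True), (u, False), (v, False)] = (f u \<otimes> f v) \<otimes> inv (f v \<otimes> f u)"
    using assms by (simp add: inv_mult_group m_assoc)
  also have "\<dots> = \<one> \<longleftrightarrow> f u \<otimes> f v = f v \<otimes> f u"
    using assms inv_solve_right'[of \<one> "f u \<otimes> f v" "f v \<otimes> f u"] by auto
  finally show ?thesis .
qed

lemma (in group) conjugates_commute: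
  assumes "g \<in> carrier G" "h \<in> carrier G" "k \<in> carrier G"
    and "(inv g \<otimes> h \<otimes> g) \<otimes> (inv g \<otimes> k \<otimes> g) = (inv g \<otimes> k \<otimes> g) \<otimes> (inv g \<otimes> h \<otimes> g)"
  shows "h \<otimes> k = k \<otimes> h"
proof -
  have mult: "(inv g \<otimes> x \<otimes> g) \<otimes> (inv g \<otimes> y \<otimes> g) = inv g \<otimes> (x \<otimes> y \<otimes> g)"
    if "x \<in> carrier G" "y \<in> carrier G" for x y
  proof -
    have "(inv g \<otimes> x \<otimes> g) \<otimes> (inv g \<otimes> y \<otimes> g) = inv g \<otimes> x \<otimes> (g \<otimes> inv g) \<otimes> (y \<otimes> g)"
      using that assms(1) by (simp only: m_assoc m_closed inv_closed)
    then show ?thesis using that assms(1) by (simp add: m_assoc)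
  qed
  have "inv g \<otimes> (h \<otimes> k \<otimes> g) = inv g \<otimes> (k \<otimes> h \<otimes> g)"
    using assms(4) unfolding mult[OF assms(2,3)] mult[OF assms(3,2)] .
  then show ?thesis using assms(1-3) by simp
qed

context finite_graph
begin

sublocale raag: group "raag \<Gamma>"
  unfolding raag_def by (rule group_presented_group)

lemma raag_gen_closed: "v \<in> pverts \<Gamma> \<Longrightarrow> raag_gen \<Gamma> v \<in> carrier (raag \<Gamma>)"
  by (simp add: raag_gen_def raag_def presented_gen_closed)

lemma raag_gens_closed: "S \<subseteq> pverts \<Gamma> \<Longrightarrow> raag_gen \<Gamma> ` S \<subseteq> carrier (raag \<Gamma>)"
  using raag_gen_closed by blast

lemma raag_generated: "generate (raag \<Gamma>) (raag_gen \<Gamma> ` pverts \<Gamma>) = carrier (raag \<Gamma>)"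
  unfolding raag_def raag_gen_def by (rule presented_group_generated)

lemma raag_relatorE:
  assumes "r \<in> raag_relators \<Gamma>"
  obtains u v where "(u, v) \<in> parcs \<Gamma>" "u \<in> pverts \<Gamma>" "v \<in> pverts \<Gamma>"
    "r = [(u, True), (v, True), (u, False), (v, False)]"
  using assms in_arcsD1 in_arcsD2 by (auto simp: raag_relators_def)

lemma raag_hom_exists:
  assumes "group H" and f: "f \<in> pverts \<Gamma> \<rightarrow> carrier H"
    and comm: "\<And>u v. (u, v) \<in> parcs \<Gamma> \<Longrightarrow> f u \<otimes>\<^bsub>H\<^esub> f v = f v \<otimes>\<^bsub>H\<^esub> f u"
  shows "\<exists>h\<in>hom (raag \<Gamma>) H. \<forall>v\<in>pverts \<Gamma>. h (raag_gen \<Gamma> v) = f v"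
proof -
  interpret H: group H by fact
  have "word_val H f r = \<one>\<^bsub>H\<^esub>" if "r \<in> raag_relators \<Gamma>" for r
    using that
  proof (rule raag_relatorE)
    fix u v assume uv: "(u, v) \<in> parcs \<Gamma>" "u \<in> pverts \<Gamma>" "v \<in> pverts \<Gamma>"
      and r: "r = [(u, True), (v, True), (u, False), (v, False)]"
    have "f u \<in> carrier H" "f v \<in> carrier H" using f uv by auto
    then show ?thesis unfolding r using comm[OF uv(1)] by (simp only: H.word_val_commutator_iff)
  qed
  then show ?thesis
    using H.presented_group_hom_exists[OF f, of "raag_relators \<Gamma>"]
    unfolding raag_def raag_gen_def by blast
qed

lemma adjacent_gens_commute:
  assumes "(u, v) \<in> parcs \<Gamma>"
  shows "raag_gen \<Gamma> u \<otimes>\<^bsub>raag \<Gamma>\<^esub> raag_gen \<Gamma> v = raag_gen \<Gamma> v \<otimes>\<^bsub>raag \<Gamma>\<^esub> raag_gen \<Gamma> u"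
proof -
  have uv: "u \<in> pverts \<Gamma>" "v \<in> pverts \<Gamma>" using assms by (auto dest: in_arcsD1 in_arcsD2)
  let ?r = "[(u, True), (v, True), (u, False), (v, False)]"
  have "word_val (raag \<Gamma>) (raag_gen \<Gamma>) ?r = \<one>\<^bsub>raag \<Gamma>\<^esub>"
    unfolding raag_def raag_gen_def
    by (rule word_val_relator) (use assms uv in \<open>auto simp: raag_relators_def\<close>)
  then show ?thesis
    using raag.word_val_commutator_iff[of "raag_gen \<Gamma>" u v] uv raag_gen_closed by simp
qed

text \<open>If \<open>u\<close> and \<open>v\<close> were not adjacent, then mapping them to two transpositions that do not commute, and
  all other generators to the identity, would respect the relators.\<close>

lemma commuting_gens_adjacent:
  assumes uv: "u \<in> pverts \<Gamma>" "v \<in> pverts \<Gamma>" "u \<noteq> v"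
    and comm: "raag_gen \<Gamma> u \<otimes>\<^bsub>raag \<Gamma>\<^esub> raag_gen \<Gamma> v = raag_gen \<Gamma> v \<otimes>\<^bsub>raag \<Gamma>\<^esub> raag_gen \<Gamma> u"
  shows "(u, v) \<in> parcs \<Gamma>"
proof (rule ccontr)
  assume nadj: "(u, v) \<notin> parcs \<Gamma>"
  let ?H = "sym_group 3" and ?s = "transpose 1 (2::nat)" and ?t = "transpose 2 (3::nat)"
  define f where "f w = (if w = u then ?s else if w = v then ?t else id)" for w
  have mult: "p \<otimes>\<^bsub>?H\<^esub> q = p \<circ> q" for p q by (simp add: sym_group_def)
  have "f w \<in> carrier ?H" for w
    by (auto simp: f_def sym_group_def permutes_id intro!: permutes_swap_id)
  moreover have "f x \<otimes>\<^bsub>?H\<^esub> f y = f y \<otimes>\<^bsub>?H\<^esub> f x" if "(x, y) \<in> parcs \<Gamma>" for x y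
    using that nadj arcs_symmetric[OF that] unfolding mult by (auto simp: f_def)
  ultimately obtain h where h: "h \<in> hom (raag \<Gamma>) ?H" "\<forall>v\<in>pverts \<Gamma>. h (raag_gen \<Gamma> v) = f v"
    using raag_hom_exists[OF sym_group_is_group, of f 3] by blast
  have gens: "raag_gen \<Gamma> u \<in> carrier (raag \<Gamma>)" "raag_gen \<Gamma> v \<in> carrier (raag \<Gamma>)"
    using uv by (auto intro: raag_gen_closed)
  have "?s \<circ> ?t = ?t \<circ> ?s"
    using hom_mult[OF h(1) gens] hom_mult[OF h(1) gens(2,1)] h(2) uv comm by (simp add: mult f_def)
  from fun_cong[OF this, of 1] show False by (simp add: transpose_def)
qed

lemma raag_sub_subgroup: "S \<subseteq> pverts \<Gamma> \<Longrightarrow> subgroup (raag_sub \<Gamma> S) (raag \<Gamma>)"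
  unfolding raag_sub_def by (intro raag.generate_is_subgroup raag_gens_closed)

lemma raag_sub_mono: "S \<subseteq> S' \<Longrightarrow> raag_sub \<Gamma> S \<subseteq> raag_sub \<Gamma> S'"
  unfolding raag_sub_def by (intro raag.mono_generate) auto

lemma raag_gen_in_sub: "v \<in> S \<Longrightarrow> raag_gen \<Gamma> v \<in> raag_sub \<Gamma> S"
  unfolding raag_sub_def by (intro generate.incl) auto

lemma clique_sub_commute:
  assumes C: "clique \<Gamma> C" and "g \<in> raag_sub \<Gamma> C" "h \<in> raag_sub \<Gamma> C"
  shows "g \<otimes>\<^bsub>raag \<Gamma>\<^esub> h = h \<otimes>\<^bsub>raag \<Gamma>\<^esub> g"
proof (rule raag.generate_commute)
  show "raag_gen \<Gamma> ` C \<subseteq> carrier (raag \<Gamma>)" using C by (intro raag_gens_closed) (simp add: clique_def)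
  show "s \<otimes>\<^bsub>raag \<Gamma>\<^esub> t = t \<otimes>\<^bsub>raag \<Gamma>\<^esub> s" if "s \<in> raag_gen \<Gamma> ` C" "t \<in> raag_gen \<Gamma> ` C" for s t
    using that C adjacent_gens_commute by (fastforce simp: clique_def)
qed (use assms in \<open>simp_all add: raag_sub_def\<close>)

section \<open>The subgroups without separating cliques are elliptic\<close>

lemma parcs_mk_symmetric_induced:
  "parcs (mk_symmetric (with_proj \<Gamma> \<restriction> S)) = {(u, v) \<in> parcs \<Gamma>. u \<in> S \<and> v \<in> S}"
  using arcs_symmetric by (auto simp: parcs_mk_symmetric)

lemma connected_induced_rtrancl:
  assumes "\<not> disconnected (with_proj \<Gamma> \<restriction> S)" "u \<in> S" "v \<in> S"
  shows "(u, v) \<in> {(u, v) \<in> parcs \<Gamma>. u \<in> S \<and> v \<in> S}\<^sup>*"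
proof -
  have "strongly_connected (with_proj (mk_symmetric (with_proj \<Gamma> \<restriction> S)))"
    using assms by (auto simp: disconnected_def Digraph_Component.connected_def)
  then have "u \<rightarrow>\<^sup>*\<^bsub>with_proj (mk_symmetric (with_proj \<Gamma> \<restriction> S))\<^esub> v"
    using assms(2,3) by (simp add: strongly_connected_def)
  from reachable_rtranclI[OF this] show ?thesis by (simp add: parcs_mk_symmetric_induced)
qed

lemma clique_has_no_separating_clique:
  assumes C: "clique \<Gamma> C"
  shows "\<not> separating_clique \<Gamma> C K"
proof -
  interpret H: pair_wf_digraph "mk_symmetric (with_proj \<Gamma> \<restriction> (C - K))"
    by (rule wf_digraph.wellformed_mk_symmetric[OF wellformed_induce_subgraph])
  have "u \<rightarrow>\<^sup>*\<^bsub>with_proj (mk_symmetric (with_proj \<Gamma> \<restriction> (C - K)))\<^esub> v"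
    if uv: "u \<in> C - K" "v \<in> C - K" for u v
  proof (cases "u = v")
    case False
    then have "(u, v) \<in> parcs (mk_symmetric (with_proj \<Gamma> \<restriction> (C - K)))"
      using uv C by (auto simp: parcs_mk_symmetric_induced clique_def)
    then show ?thesis by (intro H.reachable_adjI) simp
  qed (use uv in simp)
  then show ?thesis
    by (auto simp: separating_clique_def disconnected_def Digraph_Component.connected_def
        strongly_connected_def)
qed

text \<open>The generators in \<open>S\<close> that fix a given edge of the tree lie in its stabilizer, which is abelian, so
  they form a clique. It does not separate \<open>S\<close>, so the other generators in \<open>S\<close> are connected by
  commutation, as \<open>elliptic_if_movers_connected\<close> requires.\<close>

lemma AH_tree_elliptic:
  assumes AH: "AH_tree \<Gamma> T \<phi>" and S: "S \<subseteq> pverts \<Gamma>"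
    and no_sep: "\<And>K. \<not> separating_clique \<Gamma> S K"
  shows "elliptic T \<phi> (raag_sub \<Gamma> S)"
proof -
  interpret T: group_on_tree "raag \<Gamma>" T \<phi>
    using AH by unfold_locales (simp_all add: AH_tree_def tree_action_def)
  have "elliptic T \<phi> (generate (raag \<Gamma>) (raag_gen \<Gamma> ` S))"
  proof (rule T.elliptic_if_movers_connected)
    show "finite (raag_gen \<Gamma> ` S)" using finite_subset[OF S pair_finite_verts] by simp
    show "raag_gen \<Gamma> ` S \<subseteq> carrier (raag \<Gamma>)" using S by (rule raag_gens_closed)
    show "T.fixpoints f \<noteq> {}" if "f \<in> raag_gen \<Gamma> ` S" for f
      using that S AH unfolding AH_tree_def elliptic_def T.fixpoints_def by fastforce
  next
    fix a b f f'
    assume ab: "(a, b) \<in> parcs T"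
      and f: "f \<in> raag_gen \<Gamma> ` S" "\<not> {a, b} \<subseteq> T.fixpoints f"
      and f': "f' \<in> raag_gen \<Gamma> ` S" "\<not> {a, b} \<subseteq> T.fixpoints f'"
    define K where "K = {w \<in> S. {a, b} \<subseteq> T.fixpoints (raag_gen \<Gamma> w)}"
    obtain u v where uv: "f = raag_gen \<Gamma> u" "u \<in> S - K" "f' = raag_gen \<Gamma> v" "v \<in> S - K"
      using f f' by (auto simp: K_def)
    have "(w, w') \<in> parcs \<Gamma>" if w: "w \<in> K" "w' \<in> K" "w \<noteq> w'" for w w'
    proof (rule commuting_gens_adjacent)
      show "w \<in> pverts \<Gamma>" "w' \<in> pverts \<Gamma>" using w S by (auto simp: K_def)
      then have "raag_gen \<Gamma> w \<in> edge_stabilizer (raag \<Gamma>) \<phi> (a, b)"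
        "raag_gen \<Gamma> w' \<in> edge_stabilizer (raag \<Gamma>) \<phi> (a, b)"
        using w raag_gen_closed by (auto simp: K_def edge_stabilizer_def stabilizer_def T.fixpoints_def)
      moreover have "comm_group (raag \<Gamma>\<lparr>carrier := edge_stabilizer (raag \<Gamma>) \<phi> (a, b)\<rparr>)"
        using AH ab by (simp add: AH_tree_def)
      ultimately show "raag_gen \<Gamma> w \<otimes>\<^bsub>raag \<Gamma>\<^esub> raag_gen \<Gamma> w' = raag_gen \<Gamma> w' \<otimes>\<^bsub>raag \<Gamma>\<^esub> raag_gen \<Gamma> w"
        using comm_monoid.m_comm[OF comm_group.axioms(1)] by fastforce
    qed fact
    then have "clique \<Gamma> K" using S by (auto simp: clique_def K_def)
    then have "\<not> disconnected (with_proj \<Gamma> \<restriction> (S - K))"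
      using no_sep[of K] by (auto simp: separating_clique_def K_def)
    from connected_induced_rtrancl[OF this uv(2,4)]
    have "(raag_gen \<Gamma> u, raag_gen \<Gamma> v) \<in> {(f, f'). f' \<in> raag_gen \<Gamma> ` S \<and> \<not> {a, b} \<subseteq> T.fixpoints f' \<and>
      f \<otimes>\<^bsub>raag \<Gamma>\<^esub> f' = f' \<otimes>\<^bsub>raag \<Gamma>\<^esub> f}\<^sup>*"
    proof induction
      case (step x y)
      then have "(raag_gen \<Gamma> x, raag_gen \<Gamma> y) \<in> {(f, f'). f' \<in> raag_gen \<Gamma> ` S \<and>
          \<not> {a, b} \<subseteq> T.fixpoints f' \<and> f \<otimes>\<^bsub>raag \<Gamma>\<^esub> f' = f' \<otimes>\<^bsub>raag \<Gamma>\<^esub> f}"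
        using adjacent_gens_commute[of x y] by (auto simp: K_def)
      with step.IH show ?case by (rule rtrancl_into_rtrancl)
    qed simp
    then show "(f, f') \<in> {(f, f'). f' \<in> raag_gen \<Gamma> ` S \<and> \<not> {a, b} \<subseteq> T.fixpoints f' \<and>
      f \<otimes>\<^bsub>raag \<Gamma>\<^esub> f' = f' \<otimes>\<^bsub>raag \<Gamma>\<^esub> f}\<^sup>*"
      by (simp add: uv)
  qed
  then show ?thesis by (simp add: raag_sub_def)
qed

section \<open>Tree decompositions decompose the group\<close>

text \<open>The homomorphism \<open>\<psi>\<close> from the fundamental group to \<open>A(\<Gamma>)\<close> forgets at which vertex an element
  sits. Its inverse \<open>\<theta>\<close> sends a generator \<open>v\<close> to its copy at some vertex, \<open>home v\<close>, whose subgraph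
  contains \<open>v\<close>. All copies of \<open>v\<close> are equal in the fundamental group, since they are connected by edges
  whose groups contain \<open>v\<close>; so two adjacent generators may be moved to a vertex where both occur, and
  commute there.\<close>

lemma tree_decomposition_decomposition:
  assumes "tree_decomposition \<Gamma> (pverts \<Gamma>) \<Lambda>"
  shows "decomposition (raag \<Gamma>) (graph_of_groups \<Gamma> \<Lambda>)"
proof -
  interpret D: tree_decomposition \<Gamma> "pverts \<Gamma>" \<Lambda> by fact
  let ?A = "raag \<Gamma>" and ?\<G> = "graph_of_groups \<Gamma> \<Lambda>"
  define U where "U = ugraph \<Lambda>"
  let ?S = "fg_gens ?\<G>" and ?R = "fg_relators ?A ?\<G>"
  let ?P = "presented_group ?S ?R"
  define gen where "gen x g = presented_gen ?S ?R (x, g)" for x g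
  interpret P: group ?P by (rule group_presented_group)
  interpret U: wf_digraph U unfolding U_def by (rule D.wf)
  have ugraph: "ugraph ?\<G> = U" and vlab: "vlabel ?\<G> x = raag_sub \<Gamma> (vlabel \<Lambda> x)"
    and elab: "elabel ?\<G> e = raag_sub \<Gamma> (elabel \<Lambda> e)" for x e
    by (simp_all add: graph_of_groups_def U_def)
  have sub: "vlabel \<Lambda> x \<subseteq> pverts \<Gamma>" if "x \<in> verts U" for x
    using that D.cover unfolding U_def by blast
  have sgrp: "subgroup (raag_sub \<Gamma> (vlabel \<Lambda> x)) ?A" if "x \<in> verts U" for x
    using sub[OF that] by (rule raag_sub_subgroup)
  have closed: "g \<in> carrier ?A" if "x \<in> verts U" "g \<in> raag_sub \<Gamma> (vlabel \<Lambda> x)" for x g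
    using subgroup.mem_carrier[OF sgrp[OF that(1)] that(2)] .
  have S_iff: "(x, g) \<in> ?S \<longleftrightarrow> x \<in> verts U \<and> g \<in> raag_sub \<Gamma> (vlabel \<Lambda> x)" for x g
    by (simp add: fg_gens_def ugraph vlab)
  have gen_closed: "gen x g \<in> carrier ?P" if "x \<in> verts U" "g \<in> raag_sub \<Gamma> (vlabel \<Lambda> x)" for x g
    using that by (simp add: gen_def presented_gen_closed S_iff)
  have gen_mult: "gen x (g \<otimes>\<^bsub>?A\<^esub> h) = gen x g \<otimes>\<^bsub>?P\<^esub> gen x h"
    if x: "x \<in> verts U" and g: "g \<in> raag_sub \<Gamma> (vlabel \<Lambda> x)" and h: "h \<in> raag_sub \<Gamma> (vlabel \<Lambda> x)" for x g h
  proof -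
    let ?r = "[((x, g), True), ((x, h), True), ((x, g \<otimes>\<^bsub>?A\<^esub> h), False)]"
    have gh: "g \<otimes>\<^bsub>?A\<^esub> h \<in> raag_sub \<Gamma> (vlabel \<Lambda> x)"
      using subgroup.m_closed[OF sgrp[OF x] g h] .
    have "word_val ?P (presented_gen ?S ?R) ?r = \<one>\<^bsub>?P\<^esub>"
    proof (rule word_val_relator)
      show "?r \<in> ?R" using x g h unfolding fg_relators_def ugraph vlab by blast
      show "?r \<in> words ?S" using x g h gh by (simp add: S_iff)
    qed
    then have "gen x g \<otimes>\<^bsub>?P\<^esub> gen x h \<otimes>\<^bsub>?P\<^esub> inv\<^bsub>?P\<^esub> (gen x (g \<otimes>\<^bsub>?A\<^esub> h)) = \<one>\<^bsub>?P\<^esub>"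
      using gen_closed[OF x g] gen_closed[OF x h] gen_closed[OF x gh]
      by (simp add: gen_def[symmetric] P.m_assoc)
    then show ?thesis
      using gen_closed[OF x g] gen_closed[OF x h] gen_closed[OF x gh]
        P.inv_solve_right'[of "\<one>\<^bsub>?P\<^esub>" "gen x g \<otimes>\<^bsub>?P\<^esub> gen x h" "gen x (g \<otimes>\<^bsub>?A\<^esub> h)"] by simp
  qed
  have gen_one: "gen x \<one>\<^bsub>?A\<^esub> = \<one>\<^bsub>?P\<^esub>" if x: "x \<in> verts U" for x
  proof -
    have one: "\<one>\<^bsub>?A\<^esub> \<in> raag_sub \<Gamma> (vlabel \<Lambda> x)" using subgroup.one_closed[OF sgrp[OF x]] .
    have "gen x \<one>\<^bsub>?A\<^esub> \<otimes>\<^bsub>?P\<^esub> gen x \<one>\<^bsub>?A\<^esub> = gen x \<one>\<^bsub>?A\<^esub>"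
      using gen_mult[OF x one one] by simp
    then show ?thesis using gen_closed[OF x one] by (simp add: P.l_cancel_one')
  qed
  have gen_edge: "gen (tail U e) g = gen (head U e) g"
    if e: "e \<in> arcs U" and g: "g \<in> raag_sub \<Gamma> (elabel \<Lambda> e)" for e g
  proof -
    let ?r = "[((tail U e, g), True), ((head U e, g), False)]"
    have g': "g \<in> raag_sub \<Gamma> (vlabel \<Lambda> (tail U e))" "g \<in> raag_sub \<Gamma> (vlabel \<Lambda> (head U e))"
      using g raag_sub_mono[OF D.subset_tail[of e]] raag_sub_mono[OF D.subset_head[of e]] e
      by (auto simp: U_def)
    have "word_val ?P (presented_gen ?S ?R) ?r = \<one>\<^bsub>?P\<^esub>"
    proof (rule word_val_relator)
      show "?r \<in> ?R" using e g unfolding fg_relators_def ugraph elab by blast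
      show "?r \<in> words ?S" using e g' by (simp add: S_iff)
    qed
    then have "gen (tail U e) g \<otimes>\<^bsub>?P\<^esub> inv\<^bsub>?P\<^esub> (gen (head U e) g) = \<one>\<^bsub>?P\<^esub>"
      using gen_closed[of "head U e" g] e g' by (simp add: gen_def[symmetric])
    then show ?thesis
      using gen_closed[of "tail U e" g] gen_closed[of "head U e" g] e g'
        P.inv_solve_right'[of "\<one>\<^bsub>?P\<^esub>" "gen (tail U e) g" "gen (head U e) g"] by simp
  qed

  have "\<exists>\<psi>\<in>hom ?P ?A. \<forall>s\<in>?S. \<psi> (presented_gen ?S ?R s) = snd s"
  proof (rule raag.presented_group_hom_exists)
    show "word_val ?A snd r = \<one>\<^bsub>?A\<^esub>" if "r \<in> ?R" for r
    proof -
      consider x g h where "r = [((x, g), True), ((x, h), True), ((x, g \<otimes>\<^bsub>?A\<^esub> h), False)]"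
          "x \<in> verts U" "g \<in> raag_sub \<Gamma> (vlabel \<Lambda> x)" "h \<in> raag_sub \<Gamma> (vlabel \<Lambda> x)"
        | e g where "r = [((tail U e, g), True), ((head U e, g), False)]" "e \<in> arcs U"
          "g \<in> raag_sub \<Gamma> (elabel \<Lambda> e)"
        using \<open>r \<in> ?R\<close> by (auto simp: fg_relators_def ugraph vlab elab)
      then show ?thesis
      proof cases
        case 1
        then show ?thesis using closed[of x g] closed[of x h] by (simp flip: raag.m_assoc)
      next
        case 2
        then have "g \<in> raag_sub \<Gamma> (vlabel \<Lambda> (head U e))"
          using raag_sub_mono[OF D.subset_head[of e]] by (auto simp: U_def)
        with 2 show ?thesis using closed[of "head U e" g] by simp
      qed
    qed
    show "snd \<in> ?S \<rightarrow> carrier ?A" using closed by (auto simp: S_iff)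
  qed
  then obtain \<psi> where \<psi>: "\<psi> \<in> hom ?P ?A" and
    \<psi>_gens: "\<forall>s\<in>?S. \<psi> (presented_gen ?S ?R s) = snd s" ..
  have \<psi>_gen: "\<psi> (gen x g) = g" if "(x, g) \<in> ?S" for x g
    using bspec[OF \<psi>_gens that] by (simp add: gen_def)

  define home where "home v = (SOME x. x \<in> verts U \<and> v \<in> vlabel \<Lambda> x)" for v
  have home: "home v \<in> verts U \<and> v \<in> vlabel \<Lambda> (home v)" if "v \<in> pverts \<Gamma>" for v
    unfolding home_def by (rule someI_ex) (use that D.cover in \<open>auto simp: U_def\<close>)
  have gen_indep: "gen x (raag_gen \<Gamma> v) = gen y (raag_gen \<Gamma> v)"
    if "x \<in> verts U" "y \<in> verts U" "v \<in> vlabel \<Lambda> x" "v \<in> vlabel \<Lambda> y" for x y v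
  proof -
    have "(x, y) \<in> (ends U {e \<in> arcs U. v \<in> elabel \<Lambda> e})\<^sup>*"
      using D.subtree that unfolding U_def by blast
    then show ?thesis
    proof induction
      case (step y z)
      then obtain e where e: "e \<in> arcs U" "v \<in> elabel \<Lambda> e"
        "y = tail U e \<and> z = head U e \<or> y = head U e \<and> z = tail U e"
        by (auto simp: ends_def)
      then show ?case using step.IH gen_edge[OF e(1) raag_gen_in_sub[OF e(2)]] by auto
    qed simp
  qed
  have "\<exists>\<theta>\<in>hom ?A ?P. \<forall>v\<in>pverts \<Gamma>. \<theta> (raag_gen \<Gamma> v) = gen (home v) (raag_gen \<Gamma> v)"
  proof (rule raag_hom_exists)
    show "(\<lambda>v. gen (home v) (raag_gen \<Gamma> v)) \<in> pverts \<Gamma> \<rightarrow> carrier ?P"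
      using home gen_closed raag_gen_in_sub by blast
    fix u v assume uv: "(u, v) \<in> parcs \<Gamma>"
    have "u \<in> pverts \<Gamma>" "v \<in> pverts \<Gamma>" using uv by (auto dest: in_arcsD1 in_arcsD2)
    moreover obtain x where x: "x \<in> verts U" "u \<in> vlabel \<Lambda> x" "v \<in> vlabel \<Lambda> x"
      using D.edge_cover[of u v] uv calculation unfolding U_def by blast
    ultimately have "gen (home u) (raag_gen \<Gamma> u) = gen x (raag_gen \<Gamma> u)"
      "gen (home v) (raag_gen \<Gamma> v) = gen x (raag_gen \<Gamma> v)"
      using home gen_indep by blast+
    then show "gen (home u) (raag_gen \<Gamma> u) \<otimes>\<^bsub>?P\<^esub> gen (home v) (raag_gen \<Gamma> v) =
        gen (home v) (raag_gen \<Gamma> v) \<otimes>\<^bsub>?P\<^esub> gen (home u) (raag_gen \<Gamma> u)"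
      using gen_mult[OF x(1)] raag_gen_in_sub x(2,3) adjacent_gens_commute[OF uv] by metis
  qed (rule group_presented_group)
  then obtain \<theta> where \<theta>: "\<theta> \<in> hom ?A ?P"
    "\<And>v. v \<in> pverts \<Gamma> \<Longrightarrow> \<theta> (raag_gen \<Gamma> v) = gen (home v) (raag_gen \<Gamma> v)"
    by auto
  interpret \<theta>: group_hom ?A ?P \<theta>
    using \<theta>(1) by unfold_locales
  interpret \<psi>: group_hom ?P ?A \<psi>
    using \<psi> by unfold_locales

  have \<theta>_gen: "\<theta> g = gen x g" if x: "x \<in> verts U" and "g \<in> raag_sub \<Gamma> (vlabel \<Lambda> x)" for x g
    using that(2) unfolding raag_sub_def
  proof induction
    case one
    show ?case using gen_one[OF x] by simp
  next
    case (incl h)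
    then obtain v where v: "v \<in> vlabel \<Lambda> x" "h = raag_gen \<Gamma> v" by blast
    then have "v \<in> pverts \<Gamma>" using sub[OF x] by blast
    then show ?case using \<theta>(2) home gen_indep x v by metis
  next
    case (inv h)
    then obtain v where v: "v \<in> vlabel \<Lambda> x" "h = raag_gen \<Gamma> v" by blast
    then have "v \<in> pverts \<Gamma>" using sub[OF x] by blast
    then have h: "\<theta> h = gen x h" "h \<in> carrier ?A" "h \<in> raag_sub \<Gamma> (vlabel \<Lambda> x)"
      using \<theta>(2) home gen_indep x v raag_gen_closed raag_gen_in_sub by metis+
    have inv_h: "inv\<^bsub>?A\<^esub> h \<in> raag_sub \<Gamma> (vlabel \<Lambda> x)"
      using subgroup.m_inv_closed[OF sgrp[OF x] h(3)] .
    have "gen x (inv\<^bsub>?A\<^esub> h) \<otimes>\<^bsub>?P\<^esub> gen x h = \<one>\<^bsub>?P\<^esub>"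
      using gen_mult[OF x inv_h h(3)] h(2) gen_one[OF x] by simp
    then show ?case
      using P.inv_equality gen_closed[OF x h(3)] gen_closed[OF x inv_h] h by simp
  next
    case (eng h1 h2)
    then have "h1 \<in> raag_sub \<Gamma> (vlabel \<Lambda> x)" "h2 \<in> raag_sub \<Gamma> (vlabel \<Lambda> x)"
      by (simp_all add: raag_sub_def)
    then show ?case using eng.IH gen_mult[OF x] closed[OF x] by simp
  qed

  have "(\<theta> \<circ> \<psi>) X = id X" if "X \<in> carrier ?P" for X
  proof (rule hom_eq_on_generate[of ?P ?P "\<theta> \<circ> \<psi>" id "presented_gen ?S ?R ` ?S"])
    show "\<theta> \<circ> \<psi> \<in> hom ?P ?P" using \<psi> \<theta>(1) by (rule Group.hom_compose)
    show "id \<in> hom ?P ?P" by (auto simp: hom_def)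
    show "presented_gen ?S ?R ` ?S \<subseteq> carrier ?P" by (intro image_subsetI presented_gen_closed)
    show "(\<theta> \<circ> \<psi>) s = id s" if s_gen: "s \<in> presented_gen ?S ?R ` ?S" for s
    proof -
      obtain x g where s: "s = gen x g" "(x, g) \<in> ?S" using s_gen by (auto simp: gen_def)
      then show ?thesis using \<psi>_gen[OF s(2)] \<theta>_gen[of x g] by (simp add: S_iff)
    qed
  qed (use that presented_group_generated[of ?S ?R] P.is_group in simp_all)
  moreover have "(\<psi> \<circ> \<theta>) g = id g" if "g \<in> carrier ?A" for g
  proof (rule hom_eq_on_generate[of ?A ?A "\<psi> \<circ> \<theta>" id "raag_gen \<Gamma> ` pverts \<Gamma>"])
    show "\<psi> \<circ> \<theta> \<in> hom ?A ?A" using \<theta>(1) \<psi> by (rule Group.hom_compose)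
    show "id \<in> hom ?A ?A" by (auto simp: hom_def)
    show "(\<psi> \<circ> \<theta>) s = id s" if "s \<in> raag_gen \<Gamma> ` pverts \<Gamma>" for s
      using that \<theta>(2) \<psi>_gen home raag_gen_in_sub by (auto simp: S_iff)
  qed (use that raag_generated raag_gens_closed raag.is_group in simp_all)
  ultimately have "bij_betw \<psi> (carrier ?P) (carrier ?A)"
    using \<psi>.hom_closed \<theta>.hom_closed by (intro bij_betw_byWitness[of _ \<theta>]) auto
  then have "\<psi> \<in> iso ?P ?A" using \<psi> by (simp add: iso_def)
  moreover have "underlying_tree U"
    unfolding U_def by (intro underlying_tree_if_card D.wf D.finite_verts D.finite_arcs D.card D.conn)
  moreover have "subgroup (raag_sub \<Gamma> (elabel \<Lambda> e)) ?A" if "e \<in> arcs U" for e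
    using D.clique[of e] that by (intro raag_sub_subgroup) (simp add: clique_def U_def)
  moreover have "raag_sub \<Gamma> (elabel \<Lambda> e) \<subseteq>
      raag_sub \<Gamma> (vlabel \<Lambda> (tail U e)) \<inter> raag_sub \<Gamma> (vlabel \<Lambda> (head U e))" if "e \<in> arcs U" for e
    using raag_sub_mono[OF D.subset_tail[of e]] raag_sub_mono[OF D.subset_head[of e]] that
    by (simp add: U_def)
  ultimately show ?thesis
    unfolding decomposition_def ugraph vlab elab using sgrp \<psi>_gen
    by (auto simp: gen_def intro!: bexI[of _ \<psi>])
qed

end

theorem theorem2p4:
  fixes \<Gamma> :: "'v pair_pre_digraph" and \<Lambda> :: "'v splitting"
  assumes "pair_graph \<Gamma>"
    and "Digraph_Component.connected (with_proj \<Gamma>)"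
    and "\<not> clique \<Gamma> (pverts \<Gamma>)"
    and "separating_clique_construction \<Gamma> \<Lambda>"
  shows "vertex_elliptic_abelian_JSJ TYPE('t) \<Gamma> (graph_of_groups \<Gamma> \<Lambda>)"
proof -
  interpret finite_graph \<Gamma> using assms(1) by (simp add: finite_graph_def)
  let ?A = "raag \<Gamma>"
  define \<G> where "\<G> = graph_of_groups \<Gamma> \<Lambda>"
  have "iterated_splitting \<Gamma> \<Lambda>"
    and no_sep: "\<And>x K. x \<in> verts (ugraph \<Lambda>) \<Longrightarrow> \<not> separating_clique \<Gamma> (vlabel \<Lambda> x) K"
    using assms(4) by (auto simp: separating_clique_construction_def)
  then interpret D: tree_decomposition \<Gamma> "pverts \<Gamma>" \<Lambda>
    by (intro tree_decomposition_iterated_splitting)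
  have decomp: "decomposition ?A \<G>"
    unfolding \<G>_def by (intro tree_decomposition_decomposition D.tree_decomposition_axioms)
  then interpret B: tree_of_groups ?A \<G>
    by unfold_locales
  have ugraph: "ugraph \<G> = ugraph \<Lambda>" and vlab: "vlabel \<G> x = raag_sub \<Gamma> (vlabel \<Lambda> x)"
    and elab: "elabel \<G> e = raag_sub \<Gamma> (elabel \<Lambda> e)" for x e
    by (simp_all add: graph_of_groups_def \<G>_def)
  have sub: "vlabel \<Lambda> x \<subseteq> pverts \<Gamma>" if "x \<in> verts (ugraph \<Lambda>)" for x
    using that D.cover by blast

  have AH: "AH_tree \<Gamma> B.B B.act"
    unfolding AH_tree_def
  proof (intro conjI ballI)
    show "tree_action ?A B.B B.act" by (rule B.B_tree_action)
  next
    fix a assume "a \<in> parcs B.B"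
    obtain e g where e: "e \<in> arcs (ugraph \<Lambda>)" and g: "g \<in> carrier ?A" and
      stab: "edge_stabilizer ?A B.act a = {h \<in> carrier ?A. inv\<^bsub>?A\<^esub> g \<otimes>\<^bsub>?A\<^esub> h \<otimes>\<^bsub>?A\<^esub> g \<in> elabel \<G> e}"
      using B.edge_stabilizer_eq_conjugate[OF \<open>a \<in> parcs B.B\<close>] unfolding ugraph by blast
    have "fst a \<in> pverts B.B" "snd a \<in> pverts B.B"
      using B.B.arc_fst_in_verts[OF \<open>a \<in> parcs B.B\<close>] B.B.arc_snd_in_verts[OF \<open>a \<in> parcs B.B\<close>] .
    then have "subgroup (edge_stabilizer ?A B.act a) ?A"
      unfolding edge_stabilizer_def
      using raag.subgroups_Inter_pair[OF B.B.stabilizer_subgroup B.B.stabilizer_subgroup] by simp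
    then have "group (?A\<lparr>carrier := edge_stabilizer ?A B.act a\<rparr>)" by (rule raag.subgroup_imp_group)
    then show "comm_group (?A\<lparr>carrier := edge_stabilizer ?A B.act a\<rparr>)"
    proof (rule group.group_comm_groupI)
      fix h k assume "h \<in> carrier (?A\<lparr>carrier := edge_stabilizer ?A B.act a\<rparr>)"
        "k \<in> carrier (?A\<lparr>carrier := edge_stabilizer ?A B.act a\<rparr>)"
      then have h: "h \<in> carrier ?A" "inv\<^bsub>?A\<^esub> g \<otimes>\<^bsub>?A\<^esub> h \<otimes>\<^bsub>?A\<^esub> g \<in> raag_sub \<Gamma> (elabel \<Lambda> e)"
        and k: "k \<in> carrier ?A" "inv\<^bsub>?A\<^esub> g \<otimes>\<^bsub>?A\<^esub> k \<otimes>\<^bsub>?A\<^esub> g \<in> raag_sub \<Gamma> (elabel \<Lambda> e)"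
        unfolding stab elab by simp_all
      have "h \<otimes>\<^bsub>?A\<^esub> k = k \<otimes>\<^bsub>?A\<^esub> h"
        by (rule raag.conjugates_commute[OF g h(1) k(1) clique_sub_commute[OF D.clique[OF e] h(2) k(2)]])
      then show "h \<otimes>\<^bsub>?A\<lparr>carrier := edge_stabilizer ?A B.act a\<rparr>\<^esub> k =
          k \<otimes>\<^bsub>?A\<lparr>carrier := edge_stabilizer ?A B.act a\<rparr>\<^esub> h" by simp
    qed
  next
    fix v assume "v \<in> pverts \<Gamma>"
    then obtain x where x: "x \<in> verts (ugraph \<Lambda>)" "v \<in> vlabel \<Lambda> x" using D.cover by blast
    then have "elliptic B.B B.act (raag_sub \<Gamma> (vlabel \<Lambda> x))"
      using B.vertex_group_elliptic[of x] by (simp add: ugraph vlab)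
    then show "elliptic B.B B.act {raag_gen \<Gamma> v}"
      using raag_gen_in_sub[OF x(2)] by (auto simp: elliptic_def)
  qed

  have conjugate_elliptic: "elliptic T \<phi> {h \<in> carrier ?A. inv\<^bsub>?A\<^esub> g \<otimes>\<^bsub>?A\<^esub> h \<otimes>\<^bsub>?A\<^esub> g \<in> raag_sub \<Gamma> S}"
    if AH: "AH_tree \<Gamma> T \<phi>" and S: "S \<subseteq> pverts \<Gamma>" and no_sep: "\<And>K. \<not> separating_clique \<Gamma> S K"
      and g: "g \<in> carrier ?A"
    for T :: "'t pair_pre_digraph" and \<phi> S g
  proof -
    interpret T: group_on_tree ?A T \<phi>
      using AH by unfold_locales (simp_all add: AH_tree_def tree_action_def)
    show ?thesis
      using AH_tree_elliptic[OF AH S no_sep] subgroup.subset[OF raag_sub_subgroup[OF S]] g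
      by (rule T.elliptic_conjugate)
  qed

  have "universally_elliptic TYPE('t) \<Gamma> B.B B.act"
    unfolding universally_elliptic_def
  proof (intro conjI allI impI ballI AH)
    fix T :: "'t pair_pre_digraph" and \<phi> a assume T: "AH_tree \<Gamma> T \<phi>" and "a \<in> parcs B.B"
    obtain e g where e: "e \<in> arcs (ugraph \<Lambda>)" and g: "g \<in> carrier ?A" and
      stab: "edge_stabilizer ?A B.act a = {h \<in> carrier ?A. inv\<^bsub>?A\<^esub> g \<otimes>\<^bsub>?A\<^esub> h \<otimes>\<^bsub>?A\<^esub> g \<in> elabel \<G> e}"
      using B.edge_stabilizer_eq_conjugate[OF \<open>a \<in> parcs B.B\<close>] unfolding ugraph by blast
    have "clique \<Gamma> (elabel \<Lambda> e)" using D.clique[OF e] .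
    then show "elliptic T \<phi> (edge_stabilizer ?A B.act a)"
      unfolding stab elab
      by (intro conjugate_elliptic[OF T _ _ g] clique_has_no_separating_clique) (simp add: clique_def)
  qed
  moreover have "dominates ?A B.B B.act T \<phi>"
    if T: "universally_elliptic TYPE('t) \<Gamma> T \<phi>" for T :: "'t pair_pre_digraph" and \<phi>
    unfolding dominates_def
  proof
    fix p assume "p \<in> pverts B.B"
    then obtain x g where p: "p = B.vtx x g" and x: "x \<in> verts (ugraph \<Lambda>)" and g: "g \<in> carrier ?A"
      unfolding B.pverts_B ugraph by blast
    have "AH_tree \<Gamma> T \<phi>" using T by (simp add: universally_elliptic_def)
    then have "elliptic T \<phi> {h \<in> carrier ?A. inv\<^bsub>?A\<^esub> g \<otimes>\<^bsub>?A\<^esub> h \<otimes>\<^bsub>?A\<^esub> g \<in> raag_sub \<Gamma> (vlabel \<Lambda> x)}"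
      using sub[OF x] no_sep[OF x] g by (rule conjugate_elliptic)
    then show "elliptic T \<phi> (stabilizer ?A B.act p)"
      using B.vertex_stabilizer_eq_conjugate[of x g] x g unfolding p ugraph vlab by simp
  qed
  ultimately show ?thesis
    using decomp AH by (simp add: vertex_elliptic_abelian_JSJ_def Let_def \<G>_def)
qed

end
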